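(* Let $d\geq 2$ be an integer and let $K\subset \mathbb{R}^d$ be a compact, uniformly disconnected set which admits a Lipschitz capture. Then there exists a Lipschitz capture $F=f([0,1])$ of $K$ such that for every $x\in K$, $\Psi\text{-}\mathrm{Tan}(F,x)=\mathfrak{C}_U(\mathbb{R}^d;\mathbf{0})$.
   Context: Lipschitz capture: given $K\subset\mathbb{R}^d$, a map $f:[0,1]\to\mathbb{R}^d$, or its image $F=f([0,1])$, is a Lipschitz capture of $K$ if $f$ is Lipschitz and $K\subset F$. Uniformly disconnected: $K\subset\mathbb{R}^d$ is uniformly disconnected if there exists $\lambda>0$ such that for every pair of distinct points $x,y\in K$ and every finite sequence $p_0,p_1,\dots,p_n\in K$ with $p_0=x$ and $p_n=y$, there is some $i\in\{0,\dots,n-1\}$ with $|p_{i+1}-p_i|>\lambda|x-y|$. Spaces of closed sets: $\mathfrak{C}(\mathbb{R}^d)$ is the collection of non-empty closed subsets of $\mathbb{R}^d$; $\mathfrak{C}(\mathbb{R}^d;\mathbf{0})$ is the collection of closed subsets of $\mathbb{R}^d$ containing the origin $\mathbf{0}$; $\mathfrak{C}_U(\mathbb{R}^d;\mathbf{0})$ is the collection of those sets in $\mathfrak{C}(\mathbb{R}^d;\mathbf{0})$ all of whose connected components are unbounded. Attouch-Wets convergence: for $A,B\subset\mathbb{R}^d$ let $\mathrm{excess}(A,B)=\sup_{a\in A}\inf_{b\in B}|a-b|$ (with value $0$ if $A$ is empty). A sequence $(X_i)$ in $\mathfrak{C}(\mathbb{R}^d)$ converges to $X\in\mathfrak{C}(\mathbb{R}^d)$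 in the Attouch-Wets topology if and only if for every $r>0$, $\lim_{i\to\infty}\mathrm{excess}(X_i\cap\overline{B}(\mathbf{0},r),X)=0$ and $\lim_{i\to\infty}\mathrm{excess}(X\cap\overline{B}(\mathbf{0},r),X_i)=0$. Pseudotangents: for $X\in\mathfrak{C}(\mathbb{R}^d)$ and $x\in X$, a set $S\in\mathfrak{C}(\mathbb{R}^d)$ is a pseudotangent to $X$ at $x$ if there exist positive scales $r_i\to 0$ and points $x_i\in X$ with $x_i\to x$ such that $r_i^{-1}(X-x_i)\to S$ in the Attouch-Wets topology. $\Psi\text{-}\mathrm{Tan}(X,x)$ denotes the collection of all pseudotangents to $X$ at $x$. *)

theory Defs
  imports "HOL-Analysis.Analysis"
begin

definition lipschitz_capture :: "(real \<Rightarrow> 'a::euclidean_space) \<Rightarrow> 'a set \<Rightarrow> bool" where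
  "lipschitz_capture f K \<longleftrightarrow> (\<exists>L. L-lipschitz_on {0..1} f) \<and> K \<subseteq> f ` {0..1}"

definition uniformly_disconnected :: "'a::euclidean_space set \<Rightarrow> bool" where
  "uniformly_disconnected K \<longleftrightarrow>
    (\<exists>c>0. \<forall>x\<in>K. \<forall>y\<in>K. x \<noteq> y \<longrightarrow>
      (\<forall>n::nat. \<forall>p::nat \<Rightarrow> 'a. (\<forall>i\<le>n. p i \<in> K) \<and> p 0 = x \<and> p n = y \<longrightarrow>
        (\<exists>i<n. norm (p (Suc i) - p i) > c * norm (x - y))))"

definition closed_sets :: "'a::euclidean_space set set" where
  "closed_sets = {X. closed X \<and> X \<noteq> {}}"

definition closed_sets0 :: "'a::euclidean_space set set" where
  "closed_sets0 = {X. closed X \<and> 0 \<in> X}"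

definition closed_sets0_U :: "'a::euclidean_space set set" where
  "closed_sets0_U = {X \<in> closed_sets0. \<forall>C\<in>components X. \<not> bounded C}"

text \<open>Extended nonnegative values are used because the supremum need not be finite.
  The supremum over the empty set is \<open>0\<close> in \<^typ>\<open>ennreal\<close>, which is the required convention.\<close>

definition excess :: "'a::euclidean_space set \<Rightarrow> 'a set \<Rightarrow> ennreal" where
  "excess A B = (SUP a\<in>A. INF b\<in>B. ennreal (norm (a - b)))"

definition attouch_wets_tendsto :: "(nat \<Rightarrow> 'a::euclidean_space set) \<Rightarrow> 'a set \<Rightarrow> bool" where
  "attouch_wets_tendsto X Y \<longleftrightarrow>
    (\<forall>r>0. (\<lambda>i. excess (X i \<inter> cball 0 r) Y) \<longlonglongrightarrow> 0 \<and>
           (\<lambda>i. excess (Y \<inter> cball 0 r) (X i)) \<longlonglongrightarrow> 0)"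

text \<open>Meant for nonempty closed \<open>X\<close> and \<open>x \<in> X\<close>; the rescaled sets
  are then nonempty and closed as well.\<close>

definition pseudotangents :: "'a::euclidean_space set \<Rightarrow> 'a \<Rightarrow> 'a set set" where
  "pseudotangents X x =
    {S \<in> closed_sets. \<exists>(r::nat \<Rightarrow> real) (z::nat \<Rightarrow> 'a).
      (\<forall>i. r i > 0) \<and> r \<longlonglongrightarrow> 0 \<and> (\<forall>i. z i \<in> X) \<and> z \<longlonglongrightarrow> x \<and>
      attouch_wets_tendsto (\<lambda>i. (\<lambda>y. inverse (r i) *\<^sub>R (y - z i)) ` X) S}"

end

theory Submission
  imports Defs
begin

text \<open>
  A Lipschitz curve \<open>F\<^sub>0\<close> through \<open>K\<close> is Lebesgue null, as the dimension is at least two, so every point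
  \<open>x\<close> of \<open>K\<close> has points \<open>c\<close> off the curve arbitrarily close to it. In a tiny ball around \<open>c\<close>, which the
  curve does not meet, one can place a shrunken copy of a curve that imitates a prescribed
  set \<open>S\<close> of \<^const>\<open>closed_sets0_U\<close>, and connect it to the old curve by a segment from \<open>x\<close>.
  Blown up at \<open>c\<close>, the new curve looks like \<open>S\<close>. The centres of the blow-ups that define
  a pseudotangent may move, so it is enough that such copies accumulate at every point of \<open>K\<close>.

  The imitating curve exists (\<open>loop_approximating\<close>) because all components of \<open>S\<close> are unbounded: each
  component of a neighbourhood of \<open>S\<close> then reaches the exterior of a large ball, the exterior is
  connected, and so the neighbourhood together with the exterior is open and connected. A Lipschitz
  loop in that open set passes through any finite net of \<open>S\<close>, and inside the large ball it cannot leave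
  the neighbourhood of \<open>S\<close>.

  Up to a given scale and precision only finitely many sets need to be imitated
  (\<open>countable_subfamily_dense_upto\<close>). Hence countably many
  attachments, at the points of a countable dense subset of \<open>K\<close>, provide copies of every \<open>S\<close> near every
  point of \<open>K\<close> at arbitrarily small scales (\<open>attachment_sequence\<close>). Each copy lies in a closed ball disjoint from the
  curve as it was before, hence from \<open>K\<close>; later attachments start on \<open>K\<close> and are made so short that they avoid
  the finitely many balls already used. The attached loops have summable lengths, so the curves
  converge to a Lipschitz curve \<open>F\<close> (\<open>limit_of_growing_curves\<close>), which coincides with the
  finite stages inside the protected balls. Therefore every \<open>S\<close> in \<^const>\<open>closed_sets0_U\<close> is a pseudotangent of \<open>F\<close>
  at every point of \<open>K\<close>.

  Conversely, every pseudotangent of \<open>F\<close> lies in \<^const>\<open>closed_sets0_U\<close> because \<open>F\<close> is connected and has more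
  than one point (\<open>pseudotangents_continuum_subset\<close>): blow-ups of \<open>F\<close> are connected and large,
  so they cannot converge to a set with a bounded component.
\<close>

section \<open>Attouch-Wets convergence without suprema\<close>

text \<open>One half of Attouch-Wets closeness: inside the ball of radius \<open>R\<close>, the first set stays within
  distance \<open>e\<close> of the second. The witness \<open>b\<close> may lie outside the ball, as in \<^const>\<open>excess\<close>.\<close>

definition covered_upto :: "real \<Rightarrow> real \<Rightarrow> 'a::euclidean_space set \<Rightarrow> 'a set \<Rightarrow> bool" where
  "covered_upto R e A B \<longleftrightarrow> (\<forall>a\<in>A. norm a \<le> R \<longrightarrow> (\<exists>b\<in>B. dist a b < e))"

definition blowup :: "'a::euclidean_space \<Rightarrow> real \<Rightarrow> 'a set \<Rightarrow> 'a set" where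
  "blowup c \<rho> X = (\<lambda>y. inverse \<rho> *\<^sub>R (y - c)) ` X"

lemma covered_uptoD:
  assumes "covered_upto R e A B" "a \<in> A" "norm a \<le> R"
  obtains b where "b \<in> B" "dist a b < e"
  using assms by (auto simp: covered_upto_def)

lemma covered_upto_mono:
  assumes "covered_upto R e A B" "R' \<le> R" "e \<le> e'"
  shows "covered_upto R' e' A B"
  using assms unfolding covered_upto_def by (meson order_trans less_le_trans)

text \<open>The radius grows by \<open>e\<close> because the intermediate point may leave the ball by that much.\<close>

lemma covered_upto_trans:
  assumes AB: "covered_upto R e A B" and BC: "covered_upto (R + e) e' B C"
  shows "covered_upto R (e + e') A C"
  unfolding covered_upto_def
proof (intro ballI impI)
  fix a assume a: "a \<in> A" "norm a \<le> R"
  obtain b where b: "b \<in> B" "dist a b < e" using AB a by (rule covered_uptoD)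
  have "norm b \<le> norm a + dist a b"
    by (metis dist_norm norm_minus_commute norm_triangle_sub)
  hence "norm b \<le> R + e" using a b by linarith
  then obtain c where c: "c \<in> C" "dist b c < e'" using covered_uptoD[OF BC b(1)] by blast
  have "dist a c < e + e'" using dist_triangle[of a c b] b c by linarith
  with c show "\<exists>b\<in>C. dist a b < e + e'" by blast
qed

lemma excess_le_if_covered:
  assumes "covered_upto R e A B"
  shows "excess (A \<inter> cball 0 R) B \<le> ennreal e"
  unfolding excess_def
proof (rule SUP_least)
  fix a assume "a \<in> A \<inter> cball 0 R"
  then obtain b where b: "b \<in> B" "dist a b < e" using covered_uptoD[OF assms, of a] by auto
  show "(INF b\<in>B. ennreal (norm (a - b))) \<le> ennreal e"
    by (rule INF_lower2[OF b(1)]) (use b in \<open>auto simp: dist_norm intro!: ennreal_leI\<close>)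
qed

lemma covered_if_excess_less:
  assumes "excess (A \<inter> cball 0 R) B < ennreal e"
  shows "covered_upto R e A B"
  unfolding covered_upto_def
proof (intro ballI impI)
  fix a assume a: "a \<in> A" "norm a \<le> R"
  have "(INF b\<in>B. ennreal (norm (a - b))) \<le> excess (A \<inter> cball 0 R) B"
    unfolding excess_def by (rule SUP_upper) (use a in auto)
  with assms have "(INF b\<in>B. ennreal (norm (a - b))) < ennreal e" by simp
  then obtain b where "b \<in> B" "ennreal (norm (a - b)) < ennreal e"
    unfolding INF_less_iff by blast
  thus "\<exists>b\<in>B. dist a b < e" by (auto simp: dist_norm ennreal_less_iff)
qed

lemma excess_tendsto_0_iff_covered:
  "(\<forall>r>0. (\<lambda>i. excess (X i \<inter> cball 0 r) (Y i)) \<longlonglongrightarrow> 0) \<longleftrightarrow>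
   (\<forall>r>0. \<forall>e>0. \<forall>\<^sub>F i in sequentially. covered_upto r e (X i) (Y i))" (is "?L \<longleftrightarrow> ?R")
proof
  assume L: ?L
  show ?R
  proof (intro allI impI)
    fix r e :: real assume "0 < r" "0 < e"
    then have "\<forall>\<^sub>F i in sequentially. excess (X i \<inter> cball 0 r) (Y i) < ennreal e"
      using L by (intro order_tendstoD(2)) auto
    thus "\<forall>\<^sub>F i in sequentially. covered_upto r e (X i) (Y i)"
      by (rule eventually_mono) (rule covered_if_excess_less)
  qed
next
  assume R: ?R
  show ?L
  proof (intro allI impI order_tendstoI)
    fix r :: real and a :: ennreal assume "0 < r" "0 < a"
    then obtain b where b: "0 < b" "b < a" using dense by blast
    then obtain e where e: "b = ennreal e" "e \<ge> 0" by (cases b) auto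
    with b have e: "0 < e" "ennreal e < a" by (auto simp: less_le)
    have "\<forall>\<^sub>F i in sequentially. covered_upto r e (X i) (Y i)" using R e(1) \<open>0 < r\<close> by simp
    thus "\<forall>\<^sub>F i in sequentially. excess (X i \<inter> cball 0 r) (Y i) < a"
      by (rule eventually_mono) (meson e(2) excess_le_if_covered le_less_trans)
  qed auto
qed

lemma attouch_wets_tendsto_iff_covered:
  "attouch_wets_tendsto X S \<longleftrightarrow>
    (\<forall>r>0. \<forall>e>0. \<forall>\<^sub>F i in sequentially. covered_upto r e (X i) S \<and> covered_upto r e S (X i))"
  using excess_tendsto_0_iff_covered[of X "\<lambda>_. S"] excess_tendsto_0_iff_covered[of "\<lambda>_. S" X]
  unfolding attouch_wets_tendsto_def eventually_conj_iff by blast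

lemma mem_blowup: "\<rho> \<noteq> 0 \<Longrightarrow> y \<in> blowup c \<rho> X \<longleftrightarrow> c + \<rho> *\<^sub>R y \<in> X"
  unfolding blowup_def by (auto simp: image_iff intro!: bexI[of _ "c + \<rho> *\<^sub>R y"])

text \<open>Recording which points of a finite net lie close to a set leaves only finitely many
  possibilities at each scale, so one representative for each possibility suffices.\<close>

lemma countable_subfamily_dense_upto:
  fixes \<C> :: "'a::euclidean_space set set"
  obtains \<T> where "countable \<T>" "\<T> \<subseteq> \<C>"
    "\<And>S R e. S \<in> \<C> \<Longrightarrow> e > 0 \<Longrightarrow> \<exists>T\<in>\<T>. covered_upto R e S T \<and> covered_upto R e T S"
proof -
  have "\<exists>\<T>. finite \<T> \<and> \<T> \<subseteq> \<C> \<and>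
      (\<forall>S\<in>\<C>. \<exists>T\<in>\<T>. covered_upto (real k) (1 / Suc k) S T \<and> covered_upto (real k) (1 / Suc k) T S)"
    for k :: nat
  proof -
    define e where "e = 1 / (2 * real (Suc k))"
    have e: "e > 0" "2 * e = 1 / Suc k" unfolding e_def by (auto simp: field_simps)
    obtain D where D: "finite D" "cball (0::'a) (real k) \<subseteq> (\<Union>x\<in>D. ball x e)"
      proof -
      have "cball (0::'a) (real k) \<subseteq> (\<Union>x\<in>UNIV. ball x e)"
        using e(1) by (meson UN_I UNIV_I centre_in_ball subsetI)
      then show ?thesis using compactE_image[OF compact_cball, of UNIV "\<lambda>x. ball x e"] that
        by (metis open_ball)
    qed
    (* Sets with the same trace on the net D are 2e-close to each other. *)
    define near where "near S = {d\<in>D. \<exists>s\<in>S. dist s d < e}" for S :: "'a set"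
    have same: "covered_upto (real k) (1 / Suc k) S T" if "near S = near T" for S T
      unfolding covered_upto_def
    proof (intro ballI impI)
      fix s assume s: "s \<in> S" "norm s \<le> real k"
      then obtain d where d: "d \<in> D" "dist d s < e" using D(2) by fastforce
      then have "d \<in> near S" using s by (auto simp: near_def dist_commute)
      then have "d \<in> near T" using that by simp
      then obtain t where "t \<in> T" "dist t d < e" unfolding near_def by blast
      then show "\<exists>t\<in>T. dist s t < 1 / Suc k"
        using dist_triangle[of s t d] d e(2) by (intro bexI[of _ t]) (auto simp: dist_commute)
    qed
    have fin: "finite (near ` \<C>)"
      by (rule finite_subset[of _ "Pow D"]) (use D in \<open>auto simp: near_def\<close>)
    show ?thesis
    proof (intro exI[of _ "inv_into \<C> near ` near ` \<C>"] conjI ballI)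
      show "finite (inv_into \<C> near ` near ` \<C>)" using fin by blast
      show "inv_into \<C> near ` near ` \<C> \<subseteq> \<C>" by (auto intro: inv_into_into)
      fix S assume "S \<in> \<C>"
      then have "near (inv_into \<C> near (near S)) = near S" by (simp add: f_inv_into_f)
      then show "\<exists>T\<in>inv_into \<C> near ` near ` \<C>. covered_upto (real k) (1 / Suc k) S T \<and>
          covered_upto (real k) (1 / Suc k) T S"
        using same \<open>S \<in> \<C>\<close> by blast
    qed
  qed
  then obtain \<T> where \<T>: "\<And>k. finite (\<T> k)" "\<And>k. \<T> k \<subseteq> \<C>"
    "\<And>k S. S \<in> \<C> \<Longrightarrow> \<exists>T\<in>\<T> k. covered_upto (real k) (1 / Suc k) S T \<and> covered_upto (real k) (1 / Suc k) T S"
    by metis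
  show thesis
  proof
    show "countable (\<Union>k. \<T> k)" using \<T>(1) by (auto intro: countable_finite)
    show "(\<Union>k. \<T> k) \<subseteq> \<C>" using \<T>(2) by blast
    fix S :: "'a set" and R e :: real assume S: "S \<in> \<C>" "e > 0"
    obtain k :: nat where k: "max R (1 / e) < real k" using reals_Archimedean2 by blast
    have k': "R \<le> real k" "1 / Suc k \<le> e"
    proof -
      show "R \<le> real k" using k by simp
      have "1 / e < real (Suc k)" using k by simp
      then show "1 / Suc k \<le> e" using S(2) by (simp add: field_simps)
    qed
    show "\<exists>T\<in>\<Union>k. \<T> k. covered_upto R e S T \<and> covered_upto R e T S"
      using \<T>(3)[OF S(1), of k] covered_upto_mono[OF _ k'] by blast
  qed
qed

section \<open>Pseudotangents of a continuum\<close>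

text \<open>A bounded component of the limit would lie in a compact, relatively open piece \<open>P\<close> of it,
  separated from the remainder by a gap. The rescaled continua meet a neighbourhood of \<open>P\<close> and also
  leave it, so they have points in the middle of the gap, at a fixed distance from the limit.\<close>

lemma unbounded_components_of_limit:
  fixes X :: "nat \<Rightarrow> 'a::euclidean_space set"
  assumes conv: "attouch_wets_tendsto X S" and S: "closed S"
    and conn: "\<And>i. connected (X i)"
    and big: "\<And>B. \<forall>\<^sub>F i in sequentially. \<not> X i \<subseteq> cball 0 B"
    and C: "C \<in> components S"
  shows "\<not> bounded C"
proof
  assume "bounded C"
  have "closed C" using C S closed_components by blast
  with \<open>bounded C\<close> have "compact C" by (simp add: compact_eq_bounded_closed)
  obtain R where R: "C \<subseteq> ball 0 R" using bounded_subset_ballD[OF \<open>bounded C\<close>] by blast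
  obtain P where P: "openin (top_of_set S) P" "compact P" "C \<subseteq> P"
    using Sura_Bura_clopen_subset[OF closed_imp_locally_compact[OF S] C \<open>compact C\<close> open_ball R]
    by metis
  obtain U where U: "open U" "P = S \<inter> U" using P(1) by (auto simp: openin_open)
  have rest: "closed (S - P)"
  proof -
    have "S - P = S \<inter> - U" using U by auto
    thus ?thesis using S U by (simp add: closed_Int closed_Compl)
  qed
  obtain \<delta> where \<delta>: "\<delta> > 0" "\<And>x y. x \<in> P \<Longrightarrow> y \<in> S - P \<Longrightarrow> \<delta> \<le> dist x y"
    using separate_compact_closed[OF P(2) rest] by blast
  obtain p where p: "p \<in> P" using in_components_nonempty[OF C] P(3) by blast
  have pS: "p \<in> S" using p U by auto
  obtain B where B: "B > 0" "\<And>y. y \<in> P \<Longrightarrow> norm y \<le> B"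
    using compact_imp_bounded[OF P(2)] by (auto simp: bounded_pos)
  have near_P: "norm z \<le> B + \<delta>" if z: "infdist z P < \<delta>" for z
  proof -
    obtain q where q: "q \<in> P" "infdist z P = dist z q"
      using infdist_attains_inf[of P z] P(2) p compact_imp_closed by blast
    show ?thesis using z q B(2)[OF q(1)] norm_triangle_sub[of z q] by (simp add: dist_norm)
  qed
  have "\<forall>\<^sub>F i in sequentially. covered_upto (B + \<delta>) (\<delta>/4) (X i) S \<and> covered_upto (B + \<delta>) (\<delta>/4) S (X i)"
    using conv \<delta>(1) B(1) unfolding attouch_wets_tendsto_iff_covered by simp
  with big[of "B + \<delta>"] obtain i where i: "\<not> X i \<subseteq> cball 0 (B + \<delta>)"
      "covered_upto (B + \<delta>) (\<delta>/4) (X i) S" "covered_upto (B + \<delta>) (\<delta>/4) S (X i)"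
    using eventually_happens[OF eventually_conj] that by fastforce
  obtain y where y: "y \<in> X i" "dist p y < \<delta>/4"
    using covered_uptoD[OF i(3) pS] B(2)[OF p] \<delta>(1) by (metis add.commute add_increasing less_imp_le)
  obtain w where w: "w \<in> X i" "norm w > B + \<delta>"
    using i(1) by (auto simp: subset_eq not_le)
  have "infdist y P \<le> \<delta>/2"
    using infdist_le[OF p, of y] y \<delta>(1) by (simp add: dist_commute)
  moreover have "infdist w P \<ge> \<delta>/2" using near_P[of w] w \<delta>(1) by linarith
  moreover have "connected ((\<lambda>z. infdist z P) ` X i)"
    by (intro connected_continuous_image conn continuous_on_infdist continuous_on_id)
  ultimately have "\<delta>/2 \<in> (\<lambda>z. infdist z P) ` X i"
    using y(1) w(1) by (meson connectedD_interval imageI)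
  then obtain z where z: "z \<in> X i" "infdist z P = \<delta>/2" by auto
  have "norm z \<le> B + \<delta>" using near_P[of z] z \<delta>(1) by linarith
  then obtain s where s: "s \<in> S" "dist z s < \<delta>/4" using covered_uptoD[OF i(2) z(1)] by blast
  show False
  proof (cases "s \<in> P")
    case True
    then show False using infdist_le[OF True, of z] s z \<delta>(1) by linarith
  next
    case False
    obtain q where q: "q \<in> P" "infdist z P = dist z q"
      using infdist_attains_inf[of P z] P(2) p compact_imp_closed by blast
    have "\<delta> \<le> dist q s" using \<delta>(2) q False s by blast
    also have "\<dots> \<le> dist z q + dist z s" by (metis dist_commute dist_triangle)
    also have "\<dots> < \<delta>" using q z s \<delta>(1) by linarith
    finally show False by simp
  qed
qed

lemma pseudotangents_continuum_subset:
  fixes F :: "'a::euclidean_space set"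
  assumes F: "connected F" "a \<in> F" "b \<in> F" "a \<noteq> b"
  shows "pseudotangents F x \<subseteq> closed_sets0_U"
proof
  fix S assume "S \<in> pseudotangents F x"
  then obtain r z where S: "closed S" and r: "\<And>i. r i > 0" "r \<longlonglongrightarrow> 0" and z: "\<And>i. z i \<in> F"
    and conv: "attouch_wets_tendsto (\<lambda>i. blowup (z i) (r i) F) S"
    unfolding pseudotangents_def closed_sets_def blowup_def by blast
  have "0 \<in> closure S"
    unfolding closure_approachable
  proof (intro allI impI)
    fix e :: real assume "0 < e"
    then have "\<forall>\<^sub>F i in sequentially. covered_upto 1 e (blowup (z i) (r i) F) S"
      using conv unfolding attouch_wets_tendsto_iff_covered eventually_conj_iff by simp
    then obtain i where i: "covered_upto 1 e (blowup (z i) (r i) F) S"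
      using eventually_happens trivial_limit_sequentially by blast
    have "0 \<in> blowup (z i) (r i) F" using r(1)[of i] z by (subst mem_blowup) auto
    then show "\<exists>y\<in>S. dist y 0 < e" using covered_uptoD[OF i] by (metis dist_commute norm_zero zero_le_one)
  qed
  moreover have "\<not> bounded C" if "C \<in> components S" for C
  proof (rule unbounded_components_of_limit[OF conv S _ _ that])
    show "connected (blowup (z i) (r i) F)" for i
      unfolding blowup_def by (intro connected_continuous_image F(1) continuous_intros)
    show "\<forall>\<^sub>F i in sequentially. \<not> blowup (z i) (r i) F \<subseteq> cball 0 B" for B
    proof -
      have "(\<lambda>i. r i * (2 * B)) \<longlonglongrightarrow> 0 * (2 * B)" by (intro tendsto_intros r(2))
      then have "\<forall>\<^sub>F i in sequentially. r i * (2 * B) < norm (a - b)"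
        using F(4) by (intro order_tendstoD(2)) auto
      then show ?thesis
      proof (rule eventually_mono)
        fix i assume less: "r i * (2 * B) < norm (a - b)"
        show "\<not> blowup (z i) (r i) F \<subseteq> cball 0 B"
        proof
          assume "blowup (z i) (r i) F \<subseteq> cball 0 B"
          then have *: "norm (inverse (r i) *\<^sub>R (y - z i)) \<le> B" if "y \<in> F" for y
            using that unfolding blowup_def by (auto simp: image_subset_iff)
          have "norm (a - b) = r i * norm (inverse (r i) *\<^sub>R (a - z i) - inverse (r i) *\<^sub>R (b - z i))"
            using r(1)[of i] by (simp flip: scaleR_diff_right)
          also have "\<dots> \<le> r i * (B + B)"
            using r(1)[of i] *[OF F(2)] *[OF F(3)]
            by (intro mult_left_mono order_trans[OF norm_triangle_ineq4] add_mono) auto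
          finally show False using less by simp
        qed
      qed
    qed
  qed
  ultimately show "S \<in> closed_sets0_U"
    using S by (simp add: closed_sets0_U_def closed_sets0_def)
qed

section \<open>Lipschitz paths and loops\<close>

lemma lipschitz_on_joinpaths:
  fixes g h :: "real \<Rightarrow> 'a::metric_space"
  assumes g: "L-lipschitz_on {0..1} g" and h: "L-lipschitz_on {0..1} h"
    and eq: "pathfinish g = pathstart h"
  shows "(2 * L)-lipschitz_on {0..1} (g +++ h)"
proof -
  have "(2 * L)-lipschitz_on {0..1/2} (\<lambda>x. g (2 * x))"
  proof (rule lipschitz_onI)
    fix x y :: real assume "x \<in> {0..1/2}" "y \<in> {0..1/2}"
    then have "dist (g (2 * x)) (g (2 * y)) \<le> L * dist (2 * x) (2 * y)"
      by (intro lipschitz_onD[OF g]) auto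
    also have "dist (2 * x) (2 * y) = 2 * dist x y" by (simp add: dist_real_def abs_if)
    finally show "dist (g (2 * x)) (g (2 * y)) \<le> 2 * L * dist x y" by simp
  qed (use lipschitz_on_nonneg[OF g] in simp)
  moreover have "(2 * L)-lipschitz_on {1/2..1} (\<lambda>x. h (2 * x - 1))"
  proof (rule lipschitz_onI)
    fix x y :: real assume "x \<in> {1/2..1}" "y \<in> {1/2..1}"
    then have "dist (h (2 * x - 1)) (h (2 * y - 1)) \<le> L * dist (2 * x - 1) (2 * y - 1)"
      by (intro lipschitz_onD[OF h]) auto
    also have "dist (2 * x - 1) (2 * y - 1) = 2 * dist x y" by (simp add: dist_real_def abs_if)
    finally show "dist (h (2 * x - 1)) (h (2 * y - 1)) \<le> 2 * L * dist x y" by simp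
  qed (use lipschitz_on_nonneg[OF g] in simp)
  ultimately have "(2 * L)-lipschitz_on {0..1} (\<lambda>x. if x \<le> 1/2 then g (2 * x) else h (2 * x - 1))"
    using eq by (intro lipschitz_on_concat) (auto simp: pathfinish_def pathstart_def)
  then show ?thesis by (simp add: joinpaths_def)
qed

lemma lipschitz_on_reversepath:
  fixes g :: "real \<Rightarrow> 'a::metric_space"
  assumes "L-lipschitz_on {0..1} g"
  shows "L-lipschitz_on {0..1} (reversepath g)"
  using lipschitz_onD[OF assms, of "1 - _" "1 - _"] lipschitz_on_nonneg[OF assms]
  by (intro lipschitz_onI) (auto simp: reversepath_def dist_real_def abs_minus_commute)

lemma lipschitz_on_linepath: "(dist a b)-lipschitz_on {0..1} (linepath a b)"
proof (rule lipschitz_onI)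
  fix s t :: real
  have "linepath a b s - linepath a b t = (t - s) *\<^sub>R (a - b)"
    by (simp add: linepath_def algebra_simps)
  then show "dist (linepath a b s) (linepath a b t) \<le> dist a b * dist s t"
    by (simp add: dist_norm abs_minus_commute)
qed auto

lemma there_and_back:
  fixes p :: "real \<Rightarrow> 'a::metric_space"
  assumes "L-lipschitz_on {0..1} p"
  shows "(2 * L)-lipschitz_on {0..1} (p +++ reversepath p)"
    and "(p +++ reversepath p) ` {0..1} = p ` {0..1}"
proof -
  show "(2 * L)-lipschitz_on {0..1} (p +++ reversepath p)"
    by (intro lipschitz_on_joinpaths lipschitz_on_reversepath assms) simp
  show "(p +++ reversepath p) ` {0..1} = p ` {0..1}"
    using path_image_join[of p "reversepath p"] by (simp add: path_image_def[symmetric])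
qed

text \<open>Points of a connected open set are joined by a polynomial path in it, and a polynomial is Lipschitz
  on the unit interval because its derivative is bounded there.\<close>

lemma lipschitz_path_in_open_connected:
  fixes V :: "'a::euclidean_space set"
  assumes "open V" "connected V" "x \<in> V" "y \<in> V"
  obtains g L where "L-lipschitz_on {0..1} g" "g ` {0..1} \<subseteq> V" "pathstart g = x" "pathfinish g = y"
proof -
  obtain g where g: "polynomial_function g" "path_image g \<subseteq> V" "pathstart g = x" "pathfinish g = y"
    using connected_open_polynomial_connected[OF assms] by auto
  obtain g' where g': "polynomial_function g'" "\<And>x. (g has_vector_derivative g' x) (at x)"
    using has_vector_derivative_polynomial_function[OF g(1)] by blast
  have "compact (g' ` {0..1})"
    using continuous_on_polymonial_function[OF g'(1)] by (rule compact_continuous_image) simp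
  from compact_imp_bounded[OF this]
  obtain B where B: "B > 0" "\<And>t. t \<in> {0..1} \<Longrightarrow> norm (g' t) \<le> B"
    by (auto simp: bounded_pos)
  have "B-lipschitz_on {0..1} g"
  proof (rule bounded_derivative_imp_lipschitz)
    show "(g has_derivative (\<lambda>h. h *\<^sub>R g' t)) (at t within {0..1})" for t
      using g'(2)[of t] unfolding has_vector_derivative_def by (rule has_derivative_at_withinI)
    show "onorm (\<lambda>h. h *\<^sub>R g' t) \<le> B" if "t \<in> {0..1}" for t
    proof (rule onorm_le)
      fix h :: real
      show "norm (h *\<^sub>R g' t) \<le> B * norm h"
        using mult_right_mono[OF B(2)[OF that] norm_ge_zero[of h]] by (simp add: mult.commute)
    qed
  qed (use B in auto)
  with g that show thesis by (auto simp: path_image_def)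
qed

text \<open>The loop visits the points of \<open>A\<close> one after another, returning to \<open>w\<close> each time.\<close>

lemma lipschitz_loop_through_finite_set:
  fixes V :: "'a::euclidean_space set"
  assumes V: "open V" "connected V" "w \<in> V" and A: "finite A" "A \<subseteq> V"
  obtains g L where "L-lipschitz_on {0..1} g" "g ` {0..1} \<subseteq> V" "A \<subseteq> g ` {0..1}"
    "pathstart g = w" "pathfinish g = w"
proof -
  have "\<exists>g L. L-lipschitz_on {0..1} g \<and> g ` {0..1} \<subseteq> V \<and> A \<subseteq> g ` {0..1} \<and>
      pathstart g = w \<and> pathfinish g = w"
    using A
  proof (induction rule: finite_induct)
    case empty
    have "0-lipschitz_on {0..1} (\<lambda>_::real. w)" by (rule lipschitz_on_constant)
    with V(3) show ?case
      by (intro exI[of _ "\<lambda>_. w"] exI[of _ 0]) (auto simp: pathstart_def pathfinish_def)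
  next
    case (insert a A)
    obtain g L where g: "L-lipschitz_on {0..1} g" "g ` {0..1} \<subseteq> V" "A \<subseteq> g ` {0..1}"
      "pathstart g = w" "pathfinish g = w"
      using insert by blast
    obtain p M where p: "M-lipschitz_on {0..1} p" "p ` {0..1} \<subseteq> V" "pathstart p = w" "pathfinish p = a"
      using lipschitz_path_in_open_connected[OF V, of a] insert.prems by (metis insert_subset)
    define q where "q = p +++ reversepath p"
    define N where "N = max L (2 * M)"
    have q: "(2 * M)-lipschitz_on {0..1} q" "q ` {0..1} = p ` {0..1}"
      unfolding q_def using there_and_back[OF p(1)] by auto
    have q_ends: "pathstart q = w" "pathfinish q = w" using p unfolding q_def by auto
    have "a \<in> p ` {0..1}" using p(4) by (auto simp: pathfinish_def)
    moreover have "(g +++ q) ` {0..1} = g ` {0..1} \<union> p ` {0..1}"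
      using path_image_join[of g q] g(5) q_ends(1) q(2) by (simp add: path_image_def)
    moreover have "(2 * N)-lipschitz_on {0..1} (g +++ q)"
      using g(5) q_ends(1) unfolding N_def
      by (intro lipschitz_on_joinpaths lipschitz_on_le[OF g(1)] lipschitz_on_le[OF q(1)]) auto
    ultimately show ?case
      using g p(2) q_ends by (intro exI[of _ "g +++ q"] exI[of _ "2 * N"]) auto
  qed
  with that show thesis by blast
qed

text \<open>Splicing a short loop into a curve delays the rest of the curve, but a curve traversed at bounded
  speed changes little when it is delayed a little. The Lipschitz constant is preserved because the
  time interval grows by \<open>\<tau>\<close> instead of being rescaled.\<close>

lemma splice_loop:
  fixes f e :: "real \<Rightarrow> 'a::metric_space"
  assumes f: "L-lipschitz_on {0..} f" "0 \<le> T" "f ` {0..T} = f ` {0..}"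
    and e: "E-lipschitz_on {0..1} e" "e 0 = x" "e 1 = x"
    and x: "x \<in> f ` {0..}" and \<tau>: "0 < \<tau>" "E \<le> L * \<tau>"
  obtains f' where "L-lipschitz_on {0..} f'" "f' ` {0..T + \<tau>} = f' ` {0..}"
    "f' ` {0..} = f ` {0..} \<union> e ` {0..1}" "\<And>s. s \<ge> 0 \<Longrightarrow> dist (f' s) (f s) \<le> 2 * (L * \<tau>)"
proof -
  obtain t where t: "t \<in> {0..T}" "x = f t" using x f(3) by (metis imageE)
  have L: "L \<ge> 0" using f(1) by (rule lipschitz_on_nonneg)
  define f' where "f' s = (if s \<le> t then f s else if s \<le> t + \<tau> then e ((s - t) / \<tau>) else f (s - \<tau>))" for s
  have mid: "L-lipschitz_on {t..t+\<tau>} (\<lambda>s. e ((s - t) / \<tau>))"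
  proof (rule lipschitz_onI[OF _ L])
    fix r s assume rs: "r \<in> {t..t+\<tau>}" "s \<in> {t..t+\<tau>}"
    then have "dist (e ((r - t) / \<tau>)) (e ((s - t) / \<tau>)) \<le> E * dist ((r - t) / \<tau>) ((s - t) / \<tau>)"
      using \<tau>(1) by (intro lipschitz_onD[OF e(1)]) auto
    also have "\<dots> = E / \<tau> * dist r s"
      using \<tau>(1) by (simp add: dist_real_def flip: diff_divide_distrib)
    also have "\<dots> \<le> L * dist r s"
      using \<tau> by (intro mult_right_mono) (auto simp: field_simps)
    finally show "dist (e ((r - t) / \<tau>)) (e ((s - t) / \<tau>)) \<le> L * dist r s" .
  qed
  have late: "L-lipschitz_on {t+\<tau>..c} (\<lambda>s. f (s - \<tau>))" for c
  proof (rule lipschitz_onI[OF _ L])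
    fix r s assume "r \<in> {t+\<tau>..c}" "s \<in> {t+\<tau>..c}"
    then show "dist (f (r - \<tau>)) (f (s - \<tau>)) \<le> L * dist r s"
      using t lipschitz_onD[OF f(1), of "r - \<tau>" "s - \<tau>"] by (simp add: dist_real_def)
  qed
  have early: "L-lipschitz_on {0..t} f" using f(1) by (rule lipschitz_on_subset) auto
  have bounded: "L-lipschitz_on {0..c} f'" for c
  proof -
    have "L-lipschitz_on {t..c} (\<lambda>s. if s \<le> t + \<tau> then e ((s - t) / \<tau>) else f (s - \<tau>))"
      using \<tau>(1) t e by (intro lipschitz_on_concat mid late) auto
    from lipschitz_on_concat[OF early this] show ?thesis
      using \<tau>(1) t e unfolding f'_def by simp
  qed
  have lip: "L-lipschitz_on {0..} f'"
  proof (rule lipschitz_onI[OF _ L])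
    fix r s :: real assume "r \<in> {0..}" "s \<in> {0..}"
    then show "dist (f' r) (f' s) \<le> L * dist r s"
      using lipschitz_onD[OF bounded[of "max r s"], of r s] by simp
  qed
  have sub: "f' ` {0..} \<subseteq> f ` {0..} \<union> e ` {0..1}"
  proof
    fix y assume "y \<in> f' ` {0..}"
    then obtain s where s: "s \<ge> 0" "y = f' s" by auto
    consider "s \<le> t" | "t < s" "s \<le> t + \<tau>" | "t + \<tau> < s" by linarith
    then show "y \<in> f ` {0..} \<union> e ` {0..1}"
    proof cases
      case 1
      then show ?thesis using s by (simp add: f'_def)
    next
      case 2
      then have "(s - t) / \<tau> \<in> {0..1}" using \<tau>(1) by auto
      then show ?thesis using 2 s by (simp add: f'_def)
    next
      case 3
      then have "s - \<tau> \<in> {0..}" using t by auto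
      then show ?thesis using 3 s \<tau>(1) by (simp add: f'_def)
    qed
  qed
  have sup1: "f s \<in> f' ` {0..T + \<tau>}" if s: "s \<in> {0..T}" for s
  proof (cases "s \<le> t")
    case True
    then show ?thesis using s \<tau>(1) by (intro image_eqI[of _ _ s]) (auto simp: f'_def)
  next
    case False
    then show ?thesis using s \<tau>(1) by (intro image_eqI[of _ _ "s + \<tau>"]) (auto simp: f'_def)
  qed
  have sup2: "e s \<in> f' ` {0..T + \<tau>}" if s: "s \<in> {0..1}" for s
  proof (cases "s = 0")
    case True
    then show ?thesis using sup1[OF t(1)] t(2) e(2) by simp
  next
    case False
    then obtain r where "0 < r" "r \<le> \<tau>" "s = r / \<tau>"
      using s \<tau>(1) that[of "s * \<tau>"] by (auto intro: mult_left_le_one_le)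
    then show ?thesis using t
      by (intro image_eqI[of _ _ "t + r"]) (auto simp: f'_def)
  qed
  have sup: "f ` {0..} \<union> e ` {0..1} \<subseteq> f' ` {0..T + \<tau>}"
    unfolding f(3)[symmetric] using sup1 sup2 by blast
  have "f' ` {0..T + \<tau>} \<subseteq> f' ` {0..}" by auto
  with sub sup have im: "f' ` {0..T + \<tau>} = f' ` {0..}" "f' ` {0..} = f ` {0..} \<union> e ` {0..1}" by blast+
  show thesis
  proof (rule that[OF lip im])
    fix s :: real assume s: "s \<ge> 0"
    show "dist (f' s) (f s) \<le> 2 * (L * \<tau>)"
    proof (cases "s \<le> t")
      case True
      then show ?thesis using L \<tau>(1) by (simp add: f'_def)
    next
      case False
      have "dist (f' s) (f (max t (s - \<tau>))) \<le> L * \<tau>"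
      proof (cases "s \<le> t + \<tau>")
        case True
        have "dist (f' s) (f' t) \<le> L * dist s t"
          using lipschitz_onD[OF lip] s t by auto
        also have "\<dots> \<le> L * \<tau>" using True False L by (intro mult_left_mono) (auto simp: dist_real_def)
        finally have "dist (f' s) (f' t) \<le> L * \<tau>" .
        moreover have "f' t = f t" "max t (s - \<tau>) = t" using True by (auto simp: f'_def)
        ultimately show ?thesis by simp
      next
        case False
        then show ?thesis using \<open>\<not> s \<le> t\<close> L \<tau>(1) by (simp add: f'_def max_def)
      qed
      moreover have "dist (f (max t (s - \<tau>))) (f s) \<le> L * dist (max t (s - \<tau>)) s"
        using lipschitz_onD[OF f(1)] s t by auto
      moreover have "L * dist (max t (s - \<tau>)) s \<le> L * \<tau>"
        using False L \<tau>(1) by (intro mult_left_mono) (auto simp: dist_real_def)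
      ultimately show ?thesis using dist_triangle[of "f' s" "f s" "f (max t (s - \<tau>))"] by linarith
    qed
  qed
qed

text \<open>Read as a function of one coordinate on a hyperplane where another coordinate vanishes, the curve is
  the Lipschitz image of a null set of the target space into that space.\<close>

lemma negligible_lipschitz_curve:
  fixes f :: "real \<Rightarrow> 'a::euclidean_space"
  assumes d: "DIM('a) \<ge> 2" and f: "L-lipschitz_on A f"
  shows "negligible (f ` A)"
proof -
  obtain u v :: 'a where uv: "u \<in> Basis" "v \<in> Basis" "u \<noteq> v"
    using d by (metis One_nat_def card_2_iff' ex_card numeral_2_eq_2 subset_iff)
  define Z where "Z = {z::'a. z \<bullet> u \<in> A \<and> z \<bullet> v = 0}"
  have im: "f ` A = (\<lambda>z. f (z \<bullet> u)) ` Z"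
  proof -
    have "A \<subseteq> (\<lambda>z. z \<bullet> u) ` Z"
    proof
      fix t assume "t \<in> A"
      then have "t *\<^sub>R u \<in> Z" "(t *\<^sub>R u) \<bullet> u = t"
        using uv by (simp_all add: Z_def inner_Basis)
      then show "t \<in> (\<lambda>z. z \<bullet> u) ` Z" by force
    qed
    moreover have "(\<lambda>z. z \<bullet> u) ` Z \<subseteq> A" by (auto simp: Z_def)
    ultimately have "A = (\<lambda>z. z \<bullet> u) ` Z" by (rule equalityI)
    then have "f ` A = f ` (\<lambda>z. z \<bullet> u) ` Z" by (rule arg_cong)
    then show ?thesis unfolding image_image .
  qed
  have "negligible Z"
    by (rule negligible_subset[OF negligible_standard_hyperplane[OF uv(2), of 0]]) (auto simp: Z_def)
  then show ?thesis
    unfolding im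
  proof (rule negligible_locally_Lipschitz_image[OF order_refl])
    fix x assume x: "x \<in> Z"
    have "norm (f (y \<bullet> u) - f (x \<bullet> u)) \<le> L * norm (y - x)" if "y \<in> Z" for y
    proof -
      have "norm (f (y \<bullet> u) - f (x \<bullet> u)) \<le> L * norm (y \<bullet> u - x \<bullet> u)"
        using x that by (intro lipschitz_on_normD[OF f]) (auto simp: Z_def)
      also have "\<dots> \<le> L * norm (y - x)"
        using Basis_le_norm[OF uv(1), of "y - x"] lipschitz_on_nonneg[OF f]
        by (intro mult_left_mono) (auto simp: inner_diff_left)
      finally show ?thesis .
    qed
    then show "\<exists>T B. open T \<and> x \<in> T \<and> (\<forall>y\<in>Z \<inter> T. norm (f (y \<bullet> u) - f (x \<bullet> u)) \<le> B * norm (y - x))"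
      by (intro exI[of _ UNIV] exI[of _ L]) auto
  qed
qed

section \<open>Attaching a miniature copy of a prescribed set\<close>

text \<open>Every component of \<open>S\<close> is unbounded, so its neighbourhood meets the exterior of the ball, which is
  connected in dimension at least two: the exterior links all the pieces.\<close>

lemma connected_neighbourhood_Un_exterior:
  fixes S :: "'a::euclidean_space set"
  assumes d: "DIM('a) \<ge> 2" and S: "S \<in> closed_sets0_U" and e: "e > 0"
  shows "connected ((\<Union>s\<in>S. ball s e) \<union> - cball 0 J)"
proof -
  have ext: "connected (- cball (0::'a) J)"
    by (intro connected_complement_bounded_convex d) auto
  have piece: "connected ((\<Union>s\<in>C. ball s e) \<union> - cball 0 J)" if C: "C \<in> components S" for C
  proof -
    have "(\<Union>s\<in>C. ball s e) = (\<lambda>(x, y). x + y) ` (C \<times> ball 0 e)"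
    proof (intro equalityI subsetI)
      fix y assume "y \<in> (\<Union>s\<in>C. ball s e)"
      then obtain s where "s \<in> C" "y \<in> ball s e" by blast
      then show "y \<in> (\<lambda>(x, y). x + y) ` (C \<times> ball 0 e)"
        by (intro image_eqI[of _ _ "(s, y - s)"]) (auto simp: dist_norm norm_minus_commute)
    next
      fix y assume "y \<in> (\<lambda>(x, y). x + y) ` (C \<times> ball 0 e)"
      then obtain a b where "a \<in> C" "norm b < e" "y = a + b" by auto
      then show "y \<in> (\<Union>s\<in>C. ball s e)" by (intro UN_I[of a]) (auto simp: dist_norm)
    qed
    moreover have "connected \<dots>"
      using in_components_connected[OF C]
      by (intro connected_continuous_image connected_Times)
        (auto intro!: continuous_intros simp: split_def)
    ultimately have conn: "connected (\<Union>s\<in>C. ball s e)" by simp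
    have "\<not> bounded C" using S C by (simp add: closed_sets0_U_def)
    then obtain p where "p \<in> C" "norm p > J" unfolding bounded_iff by (meson not_le)
    moreover from this have "p \<in> (\<Union>s\<in>C. ball s e)"
      using e by (intro UN_I[of p]) auto
    ultimately have "p \<in> (\<Union>s\<in>C. ball s e) \<inter> - cball 0 J" by simp
    then show ?thesis by (intro connected_Un conn ext) blast
  qed
  obtain q :: 'a where q: "q \<in> - cball 0 J"
    using cobounded_imp_unbounded[of "- cball (0::'a) J"] by (metis bounded_cball bounded_empty all_not_in_conv double_complement)
  have "0 \<in> S" using S by (simp add: closed_sets0_U_def closed_sets0_def)
  then have "components S \<noteq> {}" by (auto simp: components_eq_empty)
  have "\<Union>((\<lambda>C. (\<Union>s\<in>C. ball s e) \<union> - cball 0 J) ` components S)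
      = (\<Union>s\<in>\<Union>(components S). ball s e) \<union> - cball 0 J"
    using \<open>components S \<noteq> {}\<close> by blast
  moreover have "connected (\<Union>((\<lambda>C. (\<Union>s\<in>C. ball s e) \<union> - cball 0 J) ` components S))"
  proof (rule connected_Union)
    show "\<Inter> ((\<lambda>C. (\<Union>s\<in>C. ball s e) \<union> - cball 0 J) ` components S) \<noteq> {}" using q by blast
  qed (use piece in auto)
  ultimately show ?thesis by simp
qed

text \<open>A loop in the connected open set of the previous lemma is close to \<open>S\<close> inside the ball,
  and a loop through a finite \<open>e\<close>-net of \<open>S\<close> comes close to all of \<open>S\<close> there. The base point \<open>w\<close> outside the
  ball is where the loop will be connected to the existing curve.\<close>

lemma loop_approximating:
  fixes S :: "'a::euclidean_space set"
  assumes d: "DIM('a) \<ge> 2" and S: "S \<in> closed_sets0_U" and e: "e > 0" and w: "norm w > J"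
  obtains g L where "L-lipschitz_on {0..1} g" "pathstart g = w" "pathfinish g = w" "0 \<in> g ` {0..1}"
    "covered_upto J e (g ` {0..1}) S" "covered_upto J e S (g ` {0..1})"
proof -
  define V where "V = (\<Union>s\<in>S. ball s e) \<union> - cball 0 J"
  have V: "open V" "connected V" "w \<in> V"
    using w connected_neighbourhood_Un_exterior[OF d S e] unfolding V_def by auto
  have S0: "closed S" "0 \<in> S" using S by (auto simp: closed_sets0_U_def closed_sets0_def)
  have "compact (S \<inter> cball 0 J)" using S0(1) by (intro closed_Int_compact compact_cball)
  moreover have "S \<inter> cball 0 J \<subseteq> (\<Union>a\<in>S. ball a e)"
    using e by (meson IntD1 UN_I centre_in_ball subsetI)
  ultimately obtain A where A: "A \<subseteq> S" "finite A" "S \<inter> cball 0 J \<subseteq> (\<Union>a\<in>A. ball a e)"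
    using compactE_image[of "S \<inter> cball 0 J" S "\<lambda>a. ball a e"] by (metis open_ball)
  have "S \<subseteq> V" using e unfolding V_def by (meson UN_I UnI1 centre_in_ball subsetI)
  then have "finite (insert 0 A)" "insert 0 A \<subseteq> V" using A S0(2) by auto
  from lipschitz_loop_through_finite_set[OF V this]
  obtain g L where g: "L-lipschitz_on {0..1} g" "g ` {0..1} \<subseteq> V" "insert 0 A \<subseteq> g ` {0..1}"
    "pathstart g = w" "pathfinish g = w"
    by blast
  have "covered_upto J e (g ` {0..1}) S"
    unfolding covered_upto_def
  proof (intro ballI impI)
    fix y assume y: "y \<in> g ` {0..1}" "norm y \<le> J"
    have "y \<in> (\<Union>s\<in>S. ball s e) \<union> - cball 0 J"
      using g(2) y(1) unfolding V_def by (rule subsetD)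
    moreover have "y \<in> cball 0 J" using y(2) by simp
    ultimately have "y \<in> (\<Union>s\<in>S. ball s e)" by blast
    then show "\<exists>b\<in>S. dist y b < e" by (auto simp: dist_commute)
  qed
  moreover have "covered_upto J e S (g ` {0..1})"
    unfolding covered_upto_def
  proof (intro ballI impI)
    fix s assume "s \<in> S" "norm s \<le> J"
    then have "s \<in> S \<inter> cball 0 J" by simp
    with A(3) have "s \<in> (\<Union>a\<in>A. ball a e)" by (rule subsetD)
    then obtain a where "a \<in> A" "dist s a < e" by (auto simp: dist_commute)
    then show "\<exists>b\<in>g ` {0..1}. dist s b < e" using g(3) by blast
  qed
  ultimately show thesis using g that[of L g] by simp
qed

text \<open>The loop \<open>h\<close> runs from \<open>x\<close> straight towards a nearby point \<open>c\<close> off \<open>F\<close>, stops at distance \<open>\<rho> (J + 1)\<close>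
  from \<open>c\<close>, traverses the approximating loop of \<open>S\<close> scaled by \<open>\<rho>\<close> and centred at \<open>c\<close>, and returns the same way. The
  segment stays outside the ball of radius \<open>\<rho> J\<close>, so inside that ball the union of \<open>F\<close> and \<open>h\<close> is
  just the scaled loop. The loop can be made arbitrarily short: \<open>c\<close> may be taken close to \<open>x\<close>,
  and \<open>\<rho>\<close> is chosen last. The set \<open>Q\<close> stands
  for the balls that have to be left alone.\<close>

lemma attach_miniature:
  fixes F Q S :: "'a::euclidean_space set"
  assumes d: "DIM('a) \<ge> 2" and F: "closed F" "negligible F" "x \<in> F" and Q: "closed Q" "x \<notin> Q"
    and S: "S \<in> closed_sets0_U" and J: "J > 0" and e: "e > 0" and \<eta>: "\<eta> > 0"
  obtains c \<rho> and h :: "real \<Rightarrow> 'a" where "0 < \<rho>" "\<rho> < \<eta>" "dist c x < \<eta>" "c \<noteq> x"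
    "\<eta>-lipschitz_on {0..1} h" "h 0 = x" "h 1 = x" "h ` {0..1} \<inter> Q = {}" "c \<in> h ` {0..1}"
    "cball c (\<rho> * J) \<inter> F = {}"
    "covered_upto J e (blowup c \<rho> (h ` {0..1})) S" "covered_upto J e S (blowup c \<rho> (h ` {0..1}))"
proof -
  obtain \<delta> where \<delta>: "\<delta> > 0" "ball x \<delta> \<inter> Q = {}"
    using Q by (metis Compl_iff disjoint_eq_subset_Compl open_Compl open_contains_ball)
  define \<theta> where "\<theta> = min \<eta> \<delta>"
  have \<theta>: "\<theta> > 0" "\<theta> \<le> \<eta>" "\<theta> \<le> \<delta>" using \<eta> \<delta> by (auto simp: \<theta>_def)
  have "\<not> ball x (\<theta>/8) \<subseteq> F"
    using negligible_subset[OF F(2)] open_not_negligible[of "ball x (\<theta>/8)"] \<theta>(1) by auto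
  then obtain c where c: "dist x c < \<theta>/8" "c \<notin> F"
    by (meson mem_ball subsetI)
  have cx: "c \<noteq> x" using c F(3) by blast
  obtain \<delta>' where \<delta>': "\<delta>' > 0" "ball c \<delta>' \<inter> F = {}"
    using F(1) c(2) by (metis Compl_iff disjoint_eq_subset_Compl open_Compl open_contains_ball)
  (* The base point of the approximating loop points from c towards x, so that the segment from x
     to the scaled loop is radial and approaches c no further than its end point. *)
  define w where "w = ((J + 1) / dist x c) *\<^sub>R (x - c)"
  have norm_w: "norm w = J + 1" using cx J by (simp add: w_def dist_norm)
  then have "norm w > J" by simp
  from loop_approximating[OF d S e this]
  obtain g L where g: "L-lipschitz_on {0..1} g" "pathstart g = w" "pathfinish g = w" "0 \<in> g ` {0..1}"
    "covered_upto J e (g ` {0..1}) S" "covered_upto J e S (g ` {0..1})" .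
  have L: "L \<ge> 0" using g(1) by (rule lipschitz_on_nonneg)
  (* The four bounds make: \<rho> itself small, the segment end between c and x, the ball of radius
     \<rho> J disjoint from F, and the scaled loop short. *)
  define \<rho> where "\<rho> = min (\<theta>/2) (min (dist x c / (J + 1)) (min (\<delta>' / (J + 1)) (\<theta> / (8 * (L + 1)))))"
  have "\<rho> \<le> \<theta>/2" "\<rho> \<le> dist x c / (J + 1)" "\<rho> \<le> \<delta>' / (J + 1)" "\<rho> \<le> \<theta> / (8 * (L + 1))"
    unfolding \<rho>_def by (rule order_refl | rule min.cobounded1 | rule min.coboundedI2)+
  moreover have \<rho>0: "\<rho> > 0" using \<theta> cx J \<delta>' L unfolding \<rho>_def by auto
  ultimately have \<rho>: "\<rho> > 0" "\<rho> < \<theta>" "\<rho> * (J + 1) \<le> dist x c" "\<rho> * (J + 1) \<le> \<delta>'" "\<rho> * (L + 1) \<le> \<theta>/8"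
    using J L \<theta>(1) by (auto simp: field_simps)
  define m where "m t = c + \<rho> *\<^sub>R g t" for t
  have m_lip: "(\<theta>/8)-lipschitz_on {0..1} m"
  proof -
    have "(\<bar>\<rho>\<bar> * L)-lipschitz_on {0..1} (\<lambda>t. \<rho> *\<^sub>R g t)" by (rule lipschitz_on_cmult[OF g(1)])
    then have "(\<bar>\<rho>\<bar> * L)-lipschitz_on {0..1} m" by (simp add: lipschitz_on_def m_def)
    moreover have "\<bar>\<rho>\<bar> * L \<le> \<theta>/8" using \<rho>(1,5) by (simp add: algebra_simps)
    ultimately show ?thesis by (rule lipschitz_on_le)
  qed
  define b where "b = c + \<rho> *\<^sub>R w"
  have b: "b = c + (\<rho> * (J + 1) / dist x c) *\<^sub>R (x - c)" by (simp add: b_def w_def)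
  define p where "p = linepath x b"
  have xb: "dist x b \<le> \<theta>/8"
  proof -
    have "x - b = (1 - \<rho> * (J + 1) / dist x c) *\<^sub>R (x - c)" by (simp add: b algebra_simps)
    then have "dist x b = \<bar>1 - \<rho> * (J + 1) / dist x c\<bar> * dist x c" by (simp add: dist_norm)
    also have "\<dots> \<le> 1 * dist x c"
      using \<rho>(1,3) J cx by (intro mult_right_mono) (auto simp: field_simps abs_le_iff)
    finally show ?thesis using c(1) by simp
  qed
  have p_lip: "(\<theta>/8)-lipschitz_on {0..1} p"
    unfolding p_def using lipschitz_on_linepath xb by (rule lipschitz_on_le)
  have far: "norm (inverse \<rho> *\<^sub>R (y - c)) > J" if y: "y \<in> p ` {0..1}" for y
  proof -
    obtain t where t: "0 \<le> t" "t \<le> 1" "y = (1 - t) *\<^sub>R x + t *\<^sub>R b"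
      using y by (auto simp: p_def linepath_def)
    (* A point of the segment is a convex combination of x and b, both of which are multiples
       of x - c when measured from c. *)
    define k where "k = \<rho> * (J + 1) / dist x c"
    define a where "a = (1 - t) + t * k"
    have "y - c = a *\<^sub>R (x - c)"
      unfolding t(3) b a_def k_def[symmetric] by (simp add: algebra_simps)
    moreover have "k \<le> 1" unfolding k_def using \<rho>(3) cx by simp
    then have "0 \<le> (1 - t) * (1 - k)" using t by simp
    then have "k \<le> a" by (simp add: a_def algebra_simps)
    then have "a * dist x c \<ge> \<rho> * (J + 1)"
      unfolding k_def using cx by (simp add: pos_divide_le_eq)
    moreover have "\<rho> * (J + 1) > 0" using \<rho>(1) J by simp
    ultimately have "norm (y - c) \<ge> \<rho> * (J + 1)"
      using abs_ge_self[of a] by (simp add: dist_norm) (meson mult_right_mono norm_ge_zero order_trans)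
    then have "J + 1 \<le> norm (y - c) / \<rho>" using \<rho>(1) by (simp add: pos_le_divide_eq mult.commute)
    then show ?thesis using \<rho>(1) by (simp add: divide_inverse mult.commute)
  qed
  define h0 where "h0 = p +++ m"
  have pm: "pathfinish p = pathstart m"
    using g(2) by (simp add: p_def b_def m_def pathstart_def)
  have h0: "(2 * (\<theta>/8))-lipschitz_on {0..1} h0" "h0 ` {0..1} = p ` {0..1} \<union> m ` {0..1}"
    unfolding h0_def using lipschitz_on_joinpaths[OF p_lip m_lip pm] path_image_join[OF pm]
    by (auto simp: path_image_def)
  define h where "h = h0 +++ reversepath h0"
  have h: "(\<theta>/2)-lipschitz_on {0..1} h" "h ` {0..1} = p ` {0..1} \<union> m ` {0..1}"
    unfolding h_def using there_and_back[OF h0(1)] h0(2) by auto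
  have ends: "h 0 = x" "h 1 = x"
    by (simp_all add: h_def h0_def p_def joinpaths_def reversepath_def linepath_def)
  have "h ` {0..1} \<subseteq> ball x \<delta>"
  proof
    fix y assume "y \<in> h ` {0..1}"
    then obtain t where t: "0 \<le> t" "t \<le> 1" "y = h t" by auto
    have "dist (h 0) (h t) \<le> \<theta>/2 * dist 0 t" using t by (intro lipschitz_onD[OF h(1)]) auto
    also have "\<dots> \<le> \<theta>/2 * 1" using t \<theta>(1) by (intro mult_left_mono) auto
    finally show "y \<in> ball x \<delta>" using t ends \<theta> by simp
  qed
  then have away: "h ` {0..1} \<inter> Q = {}" using \<delta>(2) by blast
  have blow: "blowup c \<rho> (h ` {0..1}) = blowup c \<rho> (p ` {0..1}) \<union> g ` {0..1}"
    using \<rho>(1) unfolding h(2) blowup_def image_Un by (simp add: image_image m_def)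
  show thesis
  proof (rule that[of \<rho> c h])
    show "0 < \<rho>" "\<rho> < \<eta>" using \<rho> \<theta> by auto
    show "dist c x < \<eta>" using c(1) \<theta> by (simp add: dist_commute)
    show "c \<noteq> x" by fact
    show "\<eta>-lipschitz_on {0..1} h" using h(1) by (rule lipschitz_on_le) (use \<theta> in simp)
    show "h 0 = x" "h 1 = x" "h ` {0..1} \<inter> Q = {}" by fact+
    have "c \<in> m ` {0..1}" using g(4) by (force simp: m_def)
    then show "c \<in> h ` {0..1}" using h(2) by simp
    have "cball c (\<rho> * J) \<subseteq> ball c \<delta>'" using \<rho>(1,4) by (auto simp: algebra_simps)
    then show "cball c (\<rho> * J) \<inter> F = {}" using \<delta>'(2) by blast
    show "covered_upto J e (blowup c \<rho> (h ` {0..1})) S"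
      unfolding blow covered_upto_def
    proof (intro ballI impI)
      fix y assume y: "y \<in> blowup c \<rho> (p ` {0..1}) \<union> g ` {0..1}" "norm y \<le> J"
      have "y \<notin> blowup c \<rho> (p ` {0..1})"
      proof
        assume "y \<in> blowup c \<rho> (p ` {0..1})"
        then obtain z where "z \<in> p ` {0..1}" "y = inverse \<rho> *\<^sub>R (z - c)" unfolding blowup_def by blast
        with far[of z] y(2) show False by simp
      qed
      then show "\<exists>b\<in>S. dist y b < e" using y g(5) unfolding covered_upto_def by blast
    qed
    show "covered_upto J e S (blowup c \<rho> (h ` {0..1}))"
      using g(6) unfolding blow covered_upto_def by blast
  qed
qed

section \<open>Iterating the attachment\<close>

text \<open>The images can only grow, and each is already covered within time \<open>B\<close>. Hence a point of
  some image is visited by all later curves before time \<open>B\<close>, so the limit curve comes arbitrarily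
  close to it before time \<open>B\<close> and by compactness passes through it.\<close>

lemma limit_of_growing_curves:
  fixes f :: "nat \<Rightarrow> real \<Rightarrow> 'a::euclidean_space"
  assumes lip: "\<And>n. L-lipschitz_on {0..} (f n)"
    and T: "\<And>n. T n \<le> B" "\<And>n. f n ` {0..T n} = f n ` {0..}" and B: "B > 0"
    and close: "\<And>n s. s \<ge> 0 \<Longrightarrow> dist (f (Suc n) s) (f n s) \<le> L * (1/2)^n"
    and mono: "\<And>n. f n ` {0..} \<subseteq> f (Suc n) ` {0..}"
  obtains M and \<phi> :: "real \<Rightarrow> 'a" where "M-lipschitz_on {0..1} \<phi>" "\<phi> ` {0..1} = closure (\<Union>n. f n ` {0..})"
proof -
  have L: "L \<ge> 0" using lip[of 0] by (rule lipschitz_on_nonneg)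
  have tail: "dist (f (n + k) s) (f n s) \<le> 2 * L * (1/2)^n" if s: "s \<ge> 0" for n k s
  proof -
    have "dist (f (n + k) s) (f n s) \<le> 2 * L * (1/2)^n * (1 - (1/2)^k)"
    proof (induction k)
      case (Suc k)
      have "dist (f (n + Suc k) s) (f n s) \<le> L * (1/2)^(n + k) + 2 * L * (1/2)^n * (1 - (1/2)^k)"
        using dist_triangle[of "f (n + Suc k) s" "f n s" "f (n + k) s"] close[OF s, of "n + k"] Suc
        by simp
      also have "\<dots> = 2 * L * (1/2)^n * (1 - (1/2)^Suc k)"
        by (simp add: power_add algebra_simps)
      finally show ?case .
    qed simp
    also have "\<dots> \<le> 2 * L * (1/2)^n * 1"
      using L by (intro mult_left_mono) auto
    finally show ?thesis by simp
  qed
  have small: "(\<lambda>n. 2 * L * (1/2)^n) \<longlonglongrightarrow> 0"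
    by (rule tendsto_mult_right_zero) (rule LIMSEQ_power_zero, simp)
  have "convergent (\<lambda>n. f n s)" if s: "s \<ge> 0" for s
  proof (rule Cauchy_convergent, rule metric_CauchyI)
    fix e :: real assume "0 < e"
    then have "\<forall>\<^sub>F n in sequentially. 2 * L * (1/2)^n < e/2" using small by (intro order_tendstoD(2)) auto
    then obtain N where N: "2 * L * (1/2)^N < e/2" using eventually_happens trivial_limit_sequentially by blast
    have *: "dist (f m s) (f N s) < e/2" if "m \<ge> N" for m
      using tail[OF s, of N "m - N"] N that by simp
    show "\<exists>M. \<forall>m\<ge>M. \<forall>n\<ge>M. dist (f m s) (f n s) < e"
    proof (intro exI[of _ N] allI impI)
      fix m n assume "m \<ge> N" "n \<ge> N"
      then show "dist (f m s) (f n s) < e"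
        using *[of m] *[of n] dist_triangle_half_l[of "f m s" "f N s" e "f n s"] by blast
    qed
  qed
  then obtain \<psi> where \<psi>: "\<And>s. s \<ge> 0 \<Longrightarrow> (\<lambda>n. f n s) \<longlonglongrightarrow> \<psi> s" unfolding convergent_def by metis
  have \<psi>_close: "dist (\<psi> s) (f n s) \<le> 2 * L * (1/2)^n" if "s \<ge> 0" for n s
  proof (rule LIMSEQ_le_const2)
    show "(\<lambda>m. dist (f m s) (f n s)) \<longlonglongrightarrow> dist (\<psi> s) (f n s)"
      by (intro tendsto_intros \<psi> that)
    show "\<exists>N. \<forall>m\<ge>N. dist (f m s) (f n s) \<le> 2 * L * (1/2)^n"
      using tail[OF that, of n] by (metis le_add_diff_inverse)
  qed
  have \<psi>_lip: "L-lipschitz_on {0..} \<psi>"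
  proof (rule lipschitz_onI[OF _ L])
    fix r s :: real assume rs: "r \<in> {0..}" "s \<in> {0..}"
    show "dist (\<psi> r) (\<psi> s) \<le> L * dist r s"
    proof (rule LIMSEQ_le_const2)
      show "(\<lambda>n. dist (f n r) (f n s)) \<longlonglongrightarrow> dist (\<psi> r) (\<psi> s)"
        using rs by (intro tendsto_intros \<psi>) auto
      show "\<exists>N. \<forall>n\<ge>N. dist (f n r) (f n s) \<le> L * dist r s"
        using lipschitz_onD[OF lip rs] by blast
    qed
  qed
  have compact: "compact (\<psi> ` {0..B})"
    by (intro compact_continuous_image lipschitz_on_continuous_on[OF lipschitz_on_subset[OF \<psi>_lip]]) auto
  have mono': "f n ` {0..} \<subseteq> f m ` {0..}" if "n \<le> m" for n m
    using mono that by (rule lift_Suc_mono_le)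
  have image: "\<psi> ` {0..B} = closure (\<Union>n. f n ` {0..})"
  proof
    show "\<psi> ` {0..B} \<subseteq> closure (\<Union>n. f n ` {0..})"
    proof
      fix y assume "y \<in> \<psi> ` {0..B}"
      then obtain s where s: "s \<ge> 0" "y = \<psi> s" by auto
      show "y \<in> closure (\<Union>n. f n ` {0..})"
        unfolding closure_sequential using \<psi>[OF s(1)] s by (intro exI[of _ "\<lambda>n. f n s"]) auto
    qed
    have "f n ` {0..} \<subseteq> closure (\<psi> ` {0..B})" for n
    proof
      fix q assume q: "q \<in> f n ` {0..}"
      show "q \<in> closure (\<psi> ` {0..B})"
        unfolding closure_approachable
      proof (intro allI impI)
        fix e :: real assume "0 < e"
        then have "\<forall>\<^sub>F m in sequentially. 2 * L * (1/2)^m < e \<and> m \<ge> n"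
          using small by (intro eventually_conj eventually_ge_at_top order_tendstoD(2)) auto
        then obtain m where m: "2 * L * (1/2)^m < e" "m \<ge> n"
          using eventually_happens trivial_limit_sequentially by blast
        have "q \<in> f m ` {0..T m}" using q mono'[OF m(2)] T(2)[of m] by blast
        then obtain s where s: "0 \<le> s" "s \<le> T m" "q = f m s" by auto
        have "dist (\<psi> s) q < e" using \<psi>_close[OF s(1), of m] s m by simp
        moreover have "\<psi> s \<in> \<psi> ` {0..B}" using s T(1)[of m] by auto
        ultimately show "\<exists>y\<in>\<psi> ` {0..B}. dist y q < e" by blast
      qed
    qed
    then show "closure (\<Union>n. f n ` {0..}) \<subseteq> \<psi> ` {0..B}"
      using compact_imp_closed[OF compact] by (intro closure_minimal) auto
  qed
  have "(L * \<bar>B\<bar>)-lipschitz_on {0..1} (\<lambda>s. \<psi> (B * s))"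
  proof (rule lipschitz_onI)
    fix r s :: real assume "r \<in> {0..1}" "s \<in> {0..1}"
    then have "dist (\<psi> (B * r)) (\<psi> (B * s)) \<le> L * dist (B * r) (B * s)"
      using B by (intro lipschitz_onD[OF \<psi>_lip]) auto
    also have "dist (B * r) (B * s) = \<bar>B\<bar> * dist r s"
      by (simp add: dist_real_def abs_mult flip: right_diff_distrib)
    finally show "dist (\<psi> (B * r)) (\<psi> (B * s)) \<le> L * \<bar>B\<bar> * dist r s" by (simp add: mult.assoc)
  qed (use L in simp)
  moreover have "(\<lambda>s. \<psi> (B * s)) ` {0..1} = \<psi> ` {0..B}"
  proof -
    have "(*) B ` {0..1} = {0..B}" using B by (simp add: image_mult_atLeastAtMost)
    then show ?thesis by (metis image_image)
  qed
  ultimately show thesis using image that by simp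
qed

text \<open>The \<open>n\<close>-th step attaches a copy of \<open>S n\<close> at the point \<open>x n\<close>. The set \<open>Q n\<close> is the union of
  the balls protected so far; it is kept disjoint from \<open>K\<close>, where the later loops are attached, so that
  a sufficiently short loop avoids it. The step spends time \<open>(1/2)^(n + 1)\<close>, which keeps the total time below \<open>2\<close>.\<close>

lemma attachment_sequence:
  fixes f0 :: "real \<Rightarrow> 'a::euclidean_space"
  assumes d: "DIM('a) \<ge> 2" and L: "L \<ge> 1" "L-lipschitz_on {0..} f0"
    and f0: "f0 ` {0..1} = f0 ` {0..}" "K \<subseteq> f0 ` {0..}"
    and x: "\<And>n. x n \<in> K" and S: "\<And>n. S n \<in> closed_sets0_U"
    and J: "\<And>n. J n > 0" and e: "\<And>n. e n > 0"
  obtains f :: "nat \<Rightarrow> real \<Rightarrow> 'a" and Q c \<rho> where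
    "\<And>n. L-lipschitz_on {0..} (f n)" "\<And>n. f n ` {0..2 - (1/2)^n} = f n ` {0..}"
    "\<And>n. K \<subseteq> f n ` {0..}"
    "\<And>n s. s \<ge> 0 \<Longrightarrow> dist (f (Suc n) s) (f n s) \<le> L * (1/2)^n"
    "\<And>n. f n ` {0..} \<subseteq> f (Suc n) ` {0..}"
    "\<And>n. f (Suc n) ` {0..} \<inter> Q n \<subseteq> f n ` {0..}" "\<And>n. Q n \<subseteq> Q (Suc n)"
    "\<And>n. 0 < \<rho> n" "\<And>n. \<rho> n < e n" "\<And>n. dist (c n) (x n) < e n" "\<And>n. c n \<noteq> x n"
    "\<And>n. c n \<in> f (Suc n) ` {0..}" "\<And>n. cball (c n) (\<rho> n * J n) \<subseteq> Q (Suc n)"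
    "\<And>n. covered_upto (J n) (e n) (blowup (c n) (\<rho> n) (f (Suc n) ` {0..})) (S n)"
    "\<And>n. covered_upto (J n) (e n) (S n) (blowup (c n) (\<rho> n) (f (Suc n) ` {0..}))"
proof -
  define P where "P n st \<longleftrightarrow> (case st of (f, Q) \<Rightarrow>
      L-lipschitz_on {0..} f \<and> f ` {0..2 - (1/2)^n} = f ` {0..} \<and> K \<subseteq> f ` {0..} \<and>
      closed Q \<and> Q \<inter> K = {})" for n and st :: "(real \<Rightarrow> 'a) \<times> 'a set"
  define R where "R n st st' \<longleftrightarrow> (case (st, st') of ((f, Q), (f', Q')) \<Rightarrow>
      (\<forall>s\<ge>0. dist (f' s) (f s) \<le> L * (1/2)^n) \<and> f ` {0..} \<subseteq> f' ` {0..} \<and>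
      f' ` {0..} \<inter> Q \<subseteq> f ` {0..} \<and> Q \<subseteq> Q' \<and>
      (\<exists>c \<rho>. 0 < \<rho> \<and> \<rho> < e n \<and> dist c (x n) < e n \<and> c \<noteq> x n \<and> c \<in> f' ` {0..} \<and>
        cball c (\<rho> * J n) \<subseteq> Q' \<and> covered_upto (J n) (e n) (blowup c \<rho> (f' ` {0..})) (S n) \<and>
        covered_upto (J n) (e n) (S n) (blowup c \<rho> (f' ` {0..}))))"
    for n and st st' :: "(real \<Rightarrow> 'a) \<times> 'a set"
  have "\<exists>st. \<forall>n. P n (st n) \<and> R n (st n) (st (Suc n))"
  proof (rule dependent_nat_choice)
    show "\<exists>st. P 0 st" using L(2) f0 by (intro exI[of _ "(f0, {})"]) (simp add: P_def)
    fix st n assume "P n st"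
    then obtain f Q where st: "st = (f, Q)" and f: "L-lipschitz_on {0..} f"
      "f ` {0..2 - (1/2)^n} = f ` {0..}" "K \<subseteq> f ` {0..}" and Q: "closed Q" "Q \<inter> K = {}"
      unfolding P_def by (cases st) auto
    define F where "F = f ` {0..}"
    have "continuous_on {0..2 - (1/2)^n} f"
      by (rule lipschitz_on_continuous_on[OF lipschitz_on_subset[OF f(1)]]) auto
    then have "closed F"
      unfolding F_def f(2)[symmetric] by (intro compact_imp_closed compact_continuous_image) auto
    have "negligible F" unfolding F_def using negligible_lipschitz_curve[OF d f(1)] .
    have xn: "x n \<in> F" "x n \<notin> Q" using x[of n] f(3) Q(2) unfolding F_def by auto
    define \<tau> :: real where "\<tau> = (1/2)^Suc n"
    have \<tau>: "\<tau> > 0" "2 - (1/2)^n + \<tau> = 2 - (1/2)^Suc n" "2 * (L * \<tau>) = L * (1/2)^n"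
      unfolding \<tau>_def by auto
    define \<eta> where "\<eta> = min \<tau> (e n)"
    have \<eta>: "\<eta> > 0" using \<tau>(1) e[of n] by (simp add: \<eta>_def)
    obtain c \<rho> and h :: "real \<Rightarrow> 'a" where c: "0 < \<rho>" "\<rho> < \<eta>" "dist c (x n) < \<eta>" "c \<noteq> x n"
      and h: "\<eta>-lipschitz_on {0..1} h" "h 0 = x n" "h 1 = x n" "h ` {0..1} \<inter> Q = {}" "c \<in> h ` {0..1}"
      and disj: "cball c (\<rho> * J n) \<inter> F = {}"
      and cov: "covered_upto (J n) (e n) (blowup c \<rho> (h ` {0..1})) (S n)"
        "covered_upto (J n) (e n) (S n) (blowup c \<rho> (h ` {0..1}))"
      by (rule attach_miniature[OF d \<open>closed F\<close> \<open>negligible F\<close> xn(1) Q(1) xn(2) S[of n] J[of n] e[of n] \<eta>])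
        (rule that; assumption)
    have "0 \<le> 2 - (1/2::real)^n" by (rule order_trans[of _ "2 - 1"]) (auto simp: power_le_one)
    have "\<eta> \<le> L * \<tau>" using L(1) \<tau>(1) mult_right_mono[of 1 L \<tau>] unfolding \<eta>_def by linarith
    obtain f' where f': "L-lipschitz_on {0..} f'" "f' ` {0..2 - (1/2)^n + \<tau>} = f' ` {0..}"
      "f' ` {0..} = f ` {0..} \<union> h ` {0..1}" "\<And>s. s \<ge> 0 \<Longrightarrow> dist (f' s) (f s) \<le> 2 * (L * \<tau>)"
      using splice_loop[OF f(1) \<open>0 \<le> 2 - (1/2)^n\<close> f(2) h(1-3) xn(1)[unfolded F_def] \<tau>(1) \<open>\<eta> \<le> L * \<tau>\<close>]
      by blast
    define Q' where "Q' = Q \<union> cball c (\<rho> * J n)"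
    have "P (Suc n) (f', Q')"
      using f' f(3) Q disj unfolding P_def Q'_def F_def \<tau>(2) by auto
    moreover have "R n st (f', Q')"
      unfolding R_def st prod.case
    proof (intro conjI exI[of _ c] exI[of _ \<rho>])
      show "\<forall>s\<ge>0. dist (f' s) (f s) \<le> L * (1/2)^n" using f'(4) unfolding \<tau>(3) by blast
      show "f ` {0..} \<subseteq> f' ` {0..}" using f'(3) by blast
      show "f' ` {0..} \<inter> Q \<subseteq> f ` {0..}" using f'(3) h(4) by blast
      show "Q \<subseteq> Q'" "cball c (\<rho> * J n) \<subseteq> Q'" unfolding Q'_def by auto
      show "0 < \<rho>" "c \<noteq> x n" by fact+
      show "\<rho> < e n" "dist c (x n) < e n" using c unfolding \<eta>_def by auto
      show "c \<in> f' ` {0..}" using h(5) f'(3) by blast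
      show "covered_upto (J n) (e n) (blowup c \<rho> (f' ` {0..})) (S n)"
        unfolding covered_upto_def
      proof (intro ballI impI)
        fix y assume y: "y \<in> blowup c \<rho> (f' ` {0..})" "norm y \<le> J n"
        have "c + \<rho> *\<^sub>R y \<in> cball c (\<rho> * J n)" using c(1) y(2) by (simp add: dist_norm)
        then have "y \<in> blowup c \<rho> (h ` {0..1})"
          using y(1) c(1) disj unfolding F_def f'(3) by (auto simp: mem_blowup)
        then show "\<exists>b\<in>S n. dist y b < e n" using cov(1) y(2) unfolding covered_upto_def by blast
      qed
      have "blowup c \<rho> (h ` {0..1}) \<subseteq> blowup c \<rho> (f' ` {0..})"
        unfolding f'(3) blowup_def by blast
      then show "covered_upto (J n) (e n) (S n) (blowup c \<rho> (f' ` {0..}))"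
        using cov(2) unfolding covered_upto_def by blast
    qed
    ultimately show "\<exists>st'. P (Suc n) st' \<and> R n st st'" by blast
  qed
  then obtain st where st: "\<And>n. P n (st n)" "\<And>n. R n (st n) (st (Suc n))" by blast
  define f where "f n = fst (st n)" for n
  define Q where "Q n = snd (st n)" for n
  have st_eq: "st n = (f n, Q n)" for n by (simp add: f_def Q_def)
  note P = st(1)[unfolded P_def st_eq prod.case]
  note R = st(2)[unfolded R_def st_eq prod.case]
  have "\<forall>n. \<exists>c \<rho>. 0 < \<rho> \<and> \<rho> < e n \<and> dist c (x n) < e n \<and> c \<noteq> x n \<and> c \<in> f (Suc n) ` {0..} \<and>
        cball c (\<rho> * J n) \<subseteq> Q (Suc n) \<and> covered_upto (J n) (e n) (blowup c \<rho> (f (Suc n) ` {0..})) (S n) \<and>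
        covered_upto (J n) (e n) (S n) (blowup c \<rho> (f (Suc n) ` {0..}))"
    using R by blast
  then obtain c \<rho> where "\<forall>n. 0 < \<rho> n \<and> \<rho> n < e n \<and> dist (c n) (x n) < e n \<and> c n \<noteq> x n \<and>
        c n \<in> f (Suc n) ` {0..} \<and> cball (c n) (\<rho> n * J n) \<subseteq> Q (Suc n) \<and>
        covered_upto (J n) (e n) (blowup (c n) (\<rho> n) (f (Suc n) ` {0..})) (S n) \<and>
        covered_upto (J n) (e n) (S n) (blowup (c n) (\<rho> n) (f (Suc n) ` {0..}))"
    unfolding choice_iff by blast
  with P R show thesis by (intro that[of f Q \<rho> c]) auto
qed

section \<open>Lipschitz captures with prescribed pseudotangents\<close>

theorem theorem1p1:
  fixes K :: "'a::euclidean_space set"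
  assumes "DIM('a) \<ge> 2"
    and "compact K"
    and "uniformly_disconnected K"
    and "\<exists>g. lipschitz_capture g K"
  shows "\<exists>f. lipschitz_capture f K \<and>
           (\<forall>x\<in>K. pseudotangents (f ` {0..1}) x = closed_sets0_U)"
proof (cases "K = {}")
  case True
  with assms(4) show ?thesis by blast
next
  case False
  obtain L0 and g :: "real \<Rightarrow> 'a" where g: "L0-lipschitz_on {0..1} g" "K \<subseteq> g ` {0..1}"
    using assms(4) unfolding lipschitz_capture_def by blast
  define L where "L = max 1 L0"
  have L: "L \<ge> 1" "L-lipschitz_on {0..1} g"
    using g(1) unfolding L_def by (auto intro: lipschitz_on_le)
  (* Splicing needs curves parametrized by a half-line that finish in finite time. *)
  define f0 where "f0 s = g (min s 1)" for s
  have f0_lip: "L-lipschitz_on {0..} f0"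
  proof (rule lipschitz_onI)
    fix r s :: real assume "r \<in> {0..}" "s \<in> {0..}"
    then have "dist (f0 r) (f0 s) \<le> L * dist (min r 1) (min s 1)"
      unfolding f0_def by (intro lipschitz_onD[OF L(2)]) auto
    also have "\<dots> \<le> L * dist r s"
      using L(1) by (intro mult_left_mono) (auto simp: dist_real_def)
    finally show "dist (f0 r) (f0 s) \<le> L * dist r s" .
  qed (use L in simp)
  have f0_onto: "f0 ` {0..1} = f0 ` {0..}"
  proof -
    have "f0 s \<in> f0 ` {0..1}" if "s \<ge> 0" for s
      using that by (intro image_eqI[of _ _ "min s 1"]) (auto simp: f0_def)
    then show ?thesis by auto
  qed
  have "f0 ` {0..1} = g ` {0..1}" by (intro image_cong) (auto simp: f0_def)
  with g(2) f0_onto have f0_K: "K \<subseteq> f0 ` {0..}" by simp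

  obtain D where D: "countable D" "D \<subseteq> K" "K \<subseteq> closure D" using separable by blast
  obtain \<T> where \<T>: "countable \<T>" "\<T> \<subseteq> closed_sets0_U"
    "\<And>S R e. S \<in> (closed_sets0_U :: 'a set set) \<Longrightarrow> e > 0 \<Longrightarrow>
      \<exists>T\<in>\<T>. covered_upto R e S T \<and> covered_upto R e T S"
    by (rule countable_subfamily_dense_upto[of closed_sets0_U]) (rule that; assumption)
  have "components (UNIV :: 'a set) = {UNIV}"
    by (simp add: components_eq_sing_iff)
  then have "(UNIV :: 'a set) \<in> closed_sets0_U"
    by (simp add: closed_sets0_U_def closed_sets0_def not_bounded_UNIV)
  from \<T>(3)[OF this, of 1 0] have "\<T> \<noteq> {}" by auto
  moreover have "D \<noteq> {}" using D(3) False by auto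
  (* The attachments to be made: near each point of D, at each scale, a copy of each member
     of the countable family. *)
  ultimately have tasks_nonempty: "D \<times> (UNIV :: nat set) \<times> \<T> \<noteq> {}"
    unfolding Times_empty by (intro notI) (elim disjE; simp)
  have tasks_countable: "countable (D \<times> (UNIV :: nat set) \<times> \<T>)"
    by (intro countable_SIGMA D(1) \<T>(1) countableI_type)
  define t where "t = from_nat_into (D \<times> (UNIV :: nat set) \<times> \<T>)"
  have t: "range t = D \<times> (UNIV :: nat set) \<times> \<T>"
    unfolding t_def using tasks_nonempty tasks_countable by (rule range_from_nat_into)
  define a k S where "a n = fst (t n)" and "k n = fst (snd (t n))" and "S n = snd (snd (t n))" for n
  have t_eq: "t n = (a n, k n, S n)" for n by (simp add: a_def k_def S_def)
  have "t n \<in> D \<times> (UNIV :: nat set) \<times> \<T>" for n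
    unfolding t[symmetric] by (rule rangeI)
  then have mem: "a n \<in> K" "S n \<in> closed_sets0_U" for n
    using subsetD[OF D(2), of "a n"] subsetD[OF \<T>(2), of "S n"] by (simp_all add: t_eq)
  have pos: "real (Suc (k n)) > 0" "1 / real (Suc (k n)) > 0" for n by simp_all
  (* The radius Suc (k n) exceeds k n because the limit curve is controlled only in the
     interior of the protected balls. *)
  obtain f :: "nat \<Rightarrow> real \<Rightarrow> 'a" and Q c and \<rho> :: "nat \<Rightarrow> real" where
    f: "\<And>n. L-lipschitz_on {0..} (f n)" "\<And>n. f n ` {0..2 - (1/2)^n} = f n ` {0..}"
    "\<And>n. K \<subseteq> f n ` {0..}"
    "\<And>n s. s \<ge> 0 \<Longrightarrow> dist (f (Suc n) s) (f n s) \<le> L * (1/2)^n"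
    "\<And>n. f n ` {0..} \<subseteq> f (Suc n) ` {0..}"
    and Q: "\<And>n. f (Suc n) ` {0..} \<inter> Q n \<subseteq> f n ` {0..}" "\<And>n. Q n \<subseteq> Q (Suc n)"
    and \<rho>: "\<And>n. 0 < \<rho> n" "\<And>n. \<rho> n < 1 / Suc (k n)"
    and c: "\<And>n. dist (c n) (a n) < 1 / Suc (k n)" "\<And>n. c n \<noteq> a n" "\<And>n. c n \<in> f (Suc n) ` {0..}"
    and protect: "\<And>n. cball (c n) (\<rho> n * Suc (k n)) \<subseteq> Q (Suc n)"
    and cov: "\<And>n. covered_upto (Suc (k n)) (1 / Suc (k n)) (blowup (c n) (\<rho> n) (f (Suc n) ` {0..})) (S n)"
      "\<And>n. covered_upto (Suc (k n)) (1 / Suc (k n)) (S n) (blowup (c n) (\<rho> n) (f (Suc n) ` {0..}))"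
    by (rule attachment_sequence[where x = a and S = S and J = "\<lambda>n. real (Suc (k n))"
          and e = "\<lambda>n. 1 / real (Suc (k n))", OF assms(1) L(1) f0_lip f0_onto f0_K mem pos])
      (rule that; assumption)
  define F where "F = closure (\<Union>n. f n ` {0..})"
  have fF: "f n ` {0..} \<subseteq> F" for n
    unfolding F_def by (rule order_trans[OF UN_upper closure_subset]) simp
  obtain M and \<phi> :: "real \<Rightarrow> 'a" where \<phi>: "M-lipschitz_on {0..1} \<phi>" "\<phi> ` {0..1} = F"
    unfolding F_def
    by (rule limit_of_growing_curves[of L f "\<lambda>n. 2 - (1/2)^n" 2, OF f(1) _ f(2) _ f(4) f(5)])
      (auto intro: that)
  have mono: "f n ` {0..} \<subseteq> f m ` {0..}" if "n \<le> m" for n m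
    using f(5) that by (rule lift_Suc_mono_le)
  have monoQ: "Q n \<subseteq> Q m" if "n \<le> m" for n m
    using Q(2) that by (rule lift_Suc_mono_le)
  (* Inside the open protected ball nothing changes after the copy has been attached, and taking
     the closure of the union adds nothing because the curve of that stage is closed. *)
  have settled: "F \<inter> ball (c n) (\<rho> n * Suc (k n)) \<subseteq> f (Suc n) ` {0..}" for n
  proof -
    have later: "f (Suc n + j) ` {0..} \<inter> Q (Suc n) \<subseteq> f (Suc n) ` {0..}" for j
    proof (induction j)
      case (Suc j)
      have "f (Suc (Suc n + j)) ` {0..} \<inter> Q (Suc n) \<subseteq> f (Suc n + j) ` {0..}"
        using Q(1)[of "Suc n + j"] monoQ[OF le_add1[of "Suc n" j]] by blast
      with Suc show ?case unfolding add_Suc_right by blast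
    qed simp
    have "f m ` {0..} \<inter> Q (Suc n) \<subseteq> f (Suc n) ` {0..}" for m
    proof (cases "m \<le> Suc n")
      case True
      then show ?thesis using mono by blast
    next
      case False
      then show ?thesis using later[of "m - Suc n"] by simp
    qed
    then have "ball (c n) (\<rho> n * Suc (k n)) \<inter> (\<Union>m. f m ` {0..}) \<subseteq> f (Suc n) ` {0..}"
      using protect[of n] ball_subset_cball by blast
    then have "closure (ball (c n) (\<rho> n * Suc (k n)) \<inter> (\<Union>m. f m ` {0..})) \<subseteq> closure (f (Suc n) ` {0..})"
      by (rule closure_mono)
    moreover have "closed (f (Suc n) ` {0..})"
      unfolding f(2)[symmetric]
      by (intro compact_imp_closed compact_continuous_image
          lipschitz_on_continuous_on[OF lipschitz_on_subset[OF f(1)]]) auto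
    ultimately show ?thesis
      using open_Int_closure_subset[of "ball (c n) (\<rho> n * Suc (k n))" "\<Union>m. f m ` {0..}"]
      unfolding F_def by auto
  qed
  have approx: "covered_upto (k n) (1 / Suc (k n)) (blowup (c n) (\<rho> n) F) (S n)"
    "covered_upto (Suc (k n)) (1 / Suc (k n)) (S n) (blowup (c n) (\<rho> n) F)" for n
  proof -
    show "covered_upto (k n) (1 / Suc (k n)) (blowup (c n) (\<rho> n) F) (S n)"
      unfolding covered_upto_def
    proof (intro ballI impI)
      fix y assume y: "y \<in> blowup (c n) (\<rho> n) F" "norm y \<le> k n"
      have "\<rho> n * norm y < \<rho> n * Suc (k n)" using y(2) \<rho>(1)[of n] by simp
      then have "c n + \<rho> n *\<^sub>R y \<in> ball (c n) (\<rho> n * Suc (k n))"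
        using \<rho>(1)[of n] by (simp add: dist_norm)
      with y(1) settled[of n] \<rho>(1)[of n] have "y \<in> blowup (c n) (\<rho> n) (f (Suc n) ` {0..})"
        by (auto simp: mem_blowup)
      moreover have "norm y \<le> Suc (k n)" using y(2) by simp
      ultimately show "\<exists>s\<in>S n. dist y s < 1 / Suc (k n)"
        using cov(1)[of n] unfolding covered_upto_def by blast
    qed
    have "blowup (c n) (\<rho> n) (f (Suc n) ` {0..}) \<subseteq> blowup (c n) (\<rho> n) F"
      unfolding blowup_def by (intro image_mono fF)
    then show "covered_upto (Suc (k n)) (1 / Suc (k n)) (S n) (blowup (c n) (\<rho> n) F)"
      using cov(2)[of n] unfolding covered_upto_def by blast
  qed
  have "pseudotangents F x = closed_sets0_U" if x: "x \<in> K" for x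
  proof
    (* c 0 was chosen off the curve through a 0, so F has two points. *)
    have "connected F"
      unfolding \<phi>(2)[symmetric]
      by (intro connected_continuous_image lipschitz_on_continuous_on[OF \<phi>(1)]) simp
    moreover have "c 0 \<in> F" "a 0 \<in> F" using c(3)[of 0] mem(1)[of 0] f(3)[of 0] fF by blast+
    ultimately show "pseudotangents F x \<subseteq> closed_sets0_U"
      using c(2)[of 0] by (rule pseudotangents_continuum_subset)
    show "closed_sets0_U \<subseteq> pseudotangents F x"
    proof
      fix T :: "'a set" assume T: "T \<in> closed_sets0_U"
      have "\<forall>j. \<exists>n. k n = j \<and> dist (a n) x < 1 / Suc j \<and>
          covered_upto (Suc j) (1 / Suc j) T (S n) \<and> covered_upto (Suc j) (1 / Suc j) (S n) T"
      proof
        fix j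
        have "x \<in> closure D" using x D(3) by blast
        then obtain y where y: "y \<in> D" "dist y x < 1 / Suc j"
          unfolding closure_approachable by (metis of_nat_0_less_iff zero_less_Suc zero_less_divide_1_iff)
        obtain T' where T': "T' \<in> \<T>" "covered_upto (Suc j) (1 / Suc j) T T'"
          "covered_upto (Suc j) (1 / Suc j) T' T"
          using \<T>(3)[OF T, of "1 / Suc j" "Suc j"] by auto
        have "(y, j, T') \<in> range t" using y T' t by auto
        then obtain n where "t n = (y, j, T')" by (metis imageE)
        then have "a n = y" "k n = j" "S n = T'" unfolding t_eq by simp_all
        with y(2) T'(2,3) show "\<exists>n. k n = j \<and> dist (a n) x < 1 / Suc j \<and>
            covered_upto (Suc j) (1 / Suc j) T (S n) \<and> covered_upto (Suc j) (1 / Suc j) (S n) T"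
          by (intro exI[of _ n]) simp
      qed
      then obtain n where "\<forall>j. k (n j) = j \<and> dist (a (n j)) x < 1 / Suc j \<and>
          covered_upto (Suc j) (1 / Suc j) T (S (n j)) \<and> covered_upto (Suc j) (1 / Suc j) (S (n j)) T"
        unfolding choice_iff by (rule exE)
      then have n: "\<And>j. k (n j) = j" "\<And>j. dist (a (n j)) x < 1 / Suc j"
        "\<And>j. covered_upto (Suc j) (1 / Suc j) T (S (n j))"
        "\<And>j. covered_upto (Suc j) (1 / Suc j) (S (n j)) T"
        by simp_all
      (* The centres of the blow-ups converge to x by way of the points a (n j) of D. *)
      define X where "X j = blowup (c (n j)) (\<rho> (n j)) F" for j
      have near: "covered_upto j (2 / Suc j) (X j) T" "covered_upto j (2 / Suc j) T (X j)" for j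
      proof -
        have le: "real j + 1 / Suc j \<le> Suc j" by (simp add: field_simps)
        have sum: "1 / Suc j + 1 / Suc j = 2 / real (Suc j)" by simp
        have "covered_upto j (1 / Suc j) (X j) (S (n j))"
          using approx(1)[of "n j"] by (simp add: X_def n(1))
        moreover have "covered_upto (j + 1 / Suc j) (1 / Suc j) (S (n j)) T"
          using n(4) le by (rule covered_upto_mono) simp
        ultimately show "covered_upto j (2 / Suc j) (X j) T"
          unfolding sum[symmetric] by (rule covered_upto_trans)
        have "covered_upto j (1 / Suc j) T (S (n j))"
          using n(3) by (rule covered_upto_mono) auto
        moreover have "covered_upto (j + 1 / Suc j) (1 / Suc j) (S (n j)) (X j)"
          using approx(2)[of "n j"] le unfolding X_def n(1) by (rule covered_upto_mono) simp
        ultimately show "covered_upto j (2 / Suc j) T (X j)"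
          unfolding sum[symmetric] by (rule covered_upto_trans)
      qed
      have lim0: "(\<lambda>j. 2 / real (Suc j)) \<longlonglongrightarrow> 0"
        using LIMSEQ_Suc[OF lim_const_over_n[of "2::real"]] by simp
      have conv: "attouch_wets_tendsto X T"
        unfolding attouch_wets_tendsto_iff_covered
      proof (intro allI impI)
        fix r e :: real assume "0 < r" "0 < e"
        from lim0 have "\<forall>\<^sub>F j in sequentially. 2 / real (Suc j) < e"
          using \<open>0 < e\<close> by (intro order_tendstoD(2)) auto
        moreover have "\<forall>\<^sub>F j in sequentially. r \<le> real j"
          using filterlim_real_sequentially unfolding filterlim_at_top by blast
        ultimately show "\<forall>\<^sub>F j in sequentially. covered_upto r e (X j) T \<and> covered_upto r e T (X j)"
        proof eventually_elim
          case (elim j)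
          then show ?case
            using covered_upto_mono[OF near(1)[of j]] covered_upto_mono[OF near(2)[of j]] by simp
        qed
      qed
      have "(\<lambda>j. \<rho> (n j)) \<longlonglongrightarrow> 0"
      proof (rule tendsto_sandwich[OF _ _ tendsto_const lim0])
        show "\<forall>\<^sub>F j in sequentially. 0 \<le> \<rho> (n j)" using \<rho>(1) by (simp add: less_imp_le)
        show "\<forall>\<^sub>F j in sequentially. \<rho> (n j) \<le> 2 / Suc j"
        proof (rule always_eventually, rule allI)
          fix j
          have "\<rho> (n j) < 1 / Suc j" using \<rho>(2)[of "n j"] unfolding n(1) .
          also have "\<dots> \<le> 2 / Suc j" by (rule divide_right_mono) auto
          finally show "\<rho> (n j) \<le> 2 / Suc j" by simp
        qed
      qed
      moreover have "(\<lambda>j. c (n j)) \<longlonglongrightarrow> x"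
      proof (rule metric_LIMSEQ_I)
        fix e :: real assume "0 < e"
        then obtain N where N: "\<And>j. j \<ge> N \<Longrightarrow> 2 / real (Suc j) < e"
          using order_tendstoD(2)[OF lim0] by (auto simp: eventually_sequentially)
        have "dist (c (n j)) x < e" if "j \<ge> N" for j
        proof -
          have "dist (c (n j)) x < 1 / Suc j + 1 / Suc j"
            using dist_triangle[of "c (n j)" x "a (n j)"] c(1)[of "n j"] n(2)[of j] unfolding n(1) by linarith
          then show ?thesis using N[OF that] by simp
        qed
        then show "\<exists>N. \<forall>j\<ge>N. dist (c (n j)) x < e" by blast
      qed
      moreover have "c (n j) \<in> F" for j using c(3) fF by blast
      moreover have "T \<in> closed_sets"
        using T unfolding closed_sets0_U_def closed_sets0_def closed_sets_def by blast
      ultimately show "T \<in> pseudotangents F x"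
        using conv \<rho>(1) unfolding pseudotangents_def X_def blowup_def
        by (intro CollectI conjI exI[of _ "\<lambda>j. \<rho> (n j)"] exI[of _ "\<lambda>j. c (n j)"] allI) assumption+
    qed
  qed
  moreover have "lipschitz_capture \<phi> K"
    using \<phi> f(3)[of 0] fF unfolding lipschitz_capture_def by blast
  ultimately show ?thesis using \<phi>(2) by blast
qed

end
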